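(* Let $d\geq 3$ and $\varepsilon>0$. Then there exist constants $c,c'>0$ such that the following holds. For every positive integer $n$ and every $\omega$ satisfying $c\frac{\log n}{\log\log n}\leq \omega\leq n^{1-\varepsilon}$, there exists a family of $n$ axis-parallel boxes in $\mathbb{R}^d$ such that its intersection graph $G$ satisfies $\omega(G)\leq \omega$ and $$\chi(G)\geq c'\cdot\omega\left(\frac{\log n}{\log\log n}\right)^{d-2}.$$
   Context: Boxes are closed axis-parallel boxes $\prod_{i=1}^d [a_i,b_i]$. The intersection graph of a family of sets has the members of the family as vertices, two joined by an edge if they intersect. $\omega(G)$ and $\chi(G)$ denote the clique number and chromatic number of $G$. The constants $c,c'$ depend only on $d$ and $\varepsilon$. *)

theory Defs
  imports "HOL-Analysis.Analysis" "HOL-Library.Ramsey"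
begin

text \<open>Graphs are given by a vertex set \<^term>\<open>V\<close> and a set \<^term>\<open>E\<close> of two-element edges,
  the convention under which \<^const>\<open>clique\<close> is stated in the library.\<close>

definition intersection_edges :: "'a set set \<Rightarrow> 'a set set set" where
  "intersection_edges F = {{A, B} | A B. A \<in> F \<and> B \<in> F \<and> A \<noteq> B \<and> A \<inter> B \<noteq> {}}"

text \<open>The next two are meaningful for finite \<^term>\<open>V\<close> only.\<close>

definition clique_number :: "'v set \<Rightarrow> 'v set set \<Rightarrow> nat" where
  "clique_number V E = Max {card K | K. K \<subseteq> V \<and> clique K E}"

definition proper_coloring :: "'v set \<Rightarrow> 'v set set \<Rightarrow> nat \<Rightarrow> ('v \<Rightarrow> nat) \<Rightarrow> bool" where
  "proper_coloring V E k f \<longleftrightarrow>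
     f \<in> V \<rightarrow> {..<k} \<and> (\<forall>u\<in>V. \<forall>v\<in>V. {u, v} \<in> E \<longrightarrow> f u \<noteq> f v)"

definition chromatic_number :: "'v set \<Rightarrow> 'v set set \<Rightarrow> nat" where
  "chromatic_number V E = (LEAST k. \<exists>f. proper_coloring V E k f)"

text \<open>Boxes are nonempty; degenerate sides \<^prop>\<open>a $ i = b $ i\<close> are allowed.\<close>

definition axis_parallel_box :: "(real ^ 'd) set \<Rightarrow> bool" where
  "axis_parallel_box X \<longleftrightarrow> (\<exists>a b. (\<forall>i. a $ i \<le> b $ i) \<and> X = cbox a b)"

end

theory Submission
  imports Defs "HOL-Real_Asymp.Real_Asymp"
begin

text \<open>Take all boxes of a \<open>k\<close>-adic grid that have one fixed volume \<open>v\<close>, of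
  \<open>S = l\<^bsup>d - 1\<^esup>\<close> different shapes; \<open>R\<close> boxes of each shape fill the grid. Two boxes of different
  shapes meet in volume at most \<open>v / k\<close>, so by Cauchy-Schwarz any \<open>2 R\<close> of them contain a box meeting
  at least \<open>k\<close> others. The container method then shows that there are few independent sets, and a
  random sparse subfamily \<open>A\<close> of density \<open>1 / Q\<close> has neither an independent set larger than
  \<open>O(R / Q)\<close>, i.e. than an \<open>O(1 / S)\<close> fraction of \<open>A\<close>, nor a point of depth larger than \<open>t = O(l)\<close>.
  By the Helly property of boxes the depth bounds the cliques. Replacing each box by about
  \<open>\<omega> / t\<close> perturbed copies, with \<open>k\<close> a fixed power of \<open>l\<close> and \<open>l\<close> of order \<open>log n / log log n\<close>, the
  chromatic number becomes at least of order \<open>S \<omega> / t\<close>, which is of order \<open>\<omega> l\<^bsup>d - 2\<^esup>\<close>.\<close>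

section \<open>Containers and random sparsification\<close>

text \<open>Pick a vertex \<open>v\<close> with at least \<open>k\<close> neighbours: an independent
  set either avoids \<open>v\<close>, or contains \<open>v\<close> and avoids all its neighbours.
  The second choice discards at least \<open>k + 1\<close> vertices, so it occurs at most
  \<open>card U div k\<close> times on a branch. This bounds the number of branches, and also the
  number of vertices added to a final set of fewer than \<open>M\<close>.\<close>

lemma containers_exist:
  assumes "finite U" and "k \<ge> 1" and "M \<ge> 1"
    and deg: "\<And>W. W \<subseteq> U \<Longrightarrow> M \<le> card W \<Longrightarrow> \<exists>v\<in>W. k \<le> card {u\<in>W. u \<noteq> v \<and> adj v u}"
  shows "\<exists>\<C>. finite \<C> \<and> card \<C> \<le> (card U + 1) ^ (card U div k) \<and>
    (\<forall>C\<in>\<C>. C \<subseteq> U \<and> card C \<le> M + card U div k) \<and>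
    (\<forall>I\<subseteq>U. (\<forall>u\<in>I. \<forall>v\<in>I. u \<noteq> v \<longrightarrow> \<not> adj u v) \<longrightarrow> (\<exists>C\<in>\<C>. I \<subseteq> C))"
  using assms(1) deg
proof (induction "card U" arbitrary: U rule: less_induct)
  case less
  show ?case
  proof (cases "M \<le> card U")
    case False
    then show ?thesis
      by (intro exI[of _ "{U}"]) auto
  next
    case True
    then obtain v where v: "v \<in> U" "k \<le> card {u\<in>U. u \<noteq> v \<and> adj v u}"
      using less.prems by blast
    define N where "N = {u\<in>U. u \<noteq> v \<and> adj v u}"
    define U1 where "U1 = U - {v}"
    define U2 where "U2 = U1 - N"
    define n where "n = card U"
    define q where "q = n div k"
    have fin: "finite U" "finite U1" "finite U2" "finite N"
      using less.prems by (auto simp: U1_def U2_def N_def)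
    have sub: "U1 \<subseteq> U" "U2 \<subseteq> U" "N \<subseteq> U1"
      by (auto simp: U1_def U2_def N_def)
    have n1: "card U1 + 1 = n"
      using v(1) fin(1) card_Suc_Diff1[of U v] by (simp add: U1_def n_def)
    have c2: "card U2 + card N = card U1"
      using sub(3) fin card_Diff_subset[of N U1] card_mono[of U1 N] by (simp add: U2_def)
    have kN: "k \<le> card N" using v by (simp add: N_def)
    have n2: "card U2 + 1 + k \<le> n" using c2 n1 kN by simp
    have q1: "q \<ge> 1" using n2 assms(2) by (simp add: q_def Suc_le_eq div_greater_zero_iff)
    have d1: "card U1 div k \<le> q" unfolding q_def using n1 by (intro div_le_mono) simp
    have "card U2 div k \<le> (n - k) div k" using n2 by (intro div_le_mono) simp
    also have "\<dots> = q - 1" using n2 assms(2) by (simp add: q_def le_div_geq)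
    finally have d2: "card U2 div k \<le> q - 1" .
    \<comment> \<open>\<open>G U' \<C>\<close> abbreviates the claim for the vertex set
      \<open>U'\<close>, so that one instance of the induction hypothesis serves both branches
      \<open>U1\<close> and \<open>U2\<close>.\<close>
    define G where "G U' \<C> \<longleftrightarrow> finite \<C> \<and> card \<C> \<le> (card U' + 1) ^ (card U' div k) \<and>
      (\<forall>C\<in>\<C>. C \<subseteq> U' \<and> card C \<le> M + card U' div k) \<and>
      (\<forall>I. I \<subseteq> U' \<longrightarrow> (\<forall>u\<in>I. \<forall>v\<in>I. u \<noteq> v \<longrightarrow> \<not> adj u v) \<longrightarrow> (\<exists>C\<in>\<C>. I \<subseteq> C))"
      for U' \<C>
    have ex: "\<exists>\<C>. G U' \<C>"
      if "U' \<subseteq> U" "card U' < card U" for U'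
    unfolding G_def
    proof (rule less.hyps[OF that(2)])
      show "finite U'" using that fin by (auto intro: finite_subset)
      show "\<exists>v\<in>W. k \<le> card {u\<in>W. u \<noteq> v \<and> adj v u}" if "W \<subseteq> U'" "M \<le> card W" for W
        using less.prems(2)[of W] that \<open>U' \<subseteq> U\<close> by simp
    qed
    obtain \<C>1 where "G U1 \<C>1" using ex[OF sub(1)] n1 n_def by auto
    note C1 = this[unfolded G_def, THEN conjunct1]
      this[unfolded G_def, THEN conjunct2, THEN conjunct1]
      this[unfolded G_def, THEN conjunct2, THEN conjunct2, THEN conjunct1, rule_format]
      this[unfolded G_def, THEN conjunct2, THEN conjunct2, THEN conjunct2, rule_format]
    obtain \<C>2 where "G U2 \<C>2" using ex[OF sub(2)] n2 n_def by auto
    note C2 = this[unfolded G_def, THEN conjunct1]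
      this[unfolded G_def, THEN conjunct2, THEN conjunct1]
      this[unfolded G_def, THEN conjunct2, THEN conjunct2, THEN conjunct1, rule_format]
      this[unfolded G_def, THEN conjunct2, THEN conjunct2, THEN conjunct2, rule_format]
    define \<C> where "\<C> = \<C>1 \<union> insert v ` \<C>2"
    have "card \<C> \<le> card \<C>1 + card \<C>2"
      unfolding \<C>_def using card_Un_le[of \<C>1 "insert v ` \<C>2"] card_image_le[OF C2(1), of "insert v"] by simp
    also have "card \<C>1 \<le> n ^ q"
    proof -
      have "(card U1 + 1) ^ (card U1 div k) \<le> n ^ q"
        unfolding n1 using d1 n1 by (intro power_increasing) auto
      then show ?thesis using C1(2) by simp
    qed
    also have "card \<C>2 \<le> n ^ (q - 1)"
    proof -
      have "(card U2 + 1) ^ (card U2 div k) \<le> n ^ (card U2 div k)"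
        using n2 by (intro power_mono) auto
      also have "\<dots> \<le> n ^ (q - 1)"
        using d2 n1 by (intro power_increasing) auto
      finally show ?thesis using C2(2) by simp
    qed
    \<comment> \<open>The power of \<open>n\<close> saved on the second branch closes the recursion:
      the sum stays below \<open>(n + 1) ^ q\<close>.\<close>
    also have "n ^ q + n ^ (q - 1) = (n + 1) * n ^ (q - 1)"
      using q1 by (cases q) auto
    also have "\<dots> \<le> (n + 1) * (n + 1) ^ (q - 1)"
      by (intro mult_left_mono power_mono) auto
    also have "\<dots> = (n + 1) ^ q"
      using q1 by (cases q) auto
    finally have card: "card \<C> \<le> (n + 1) ^ q" by simp
    have "C \<subseteq> U \<and> card C \<le> M + q" if "C \<in> \<C>" for C
      using that unfolding \<C>_def
    proof
      assume "C \<in> \<C>1"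
      then show ?thesis using C1(3)[of C] d1 sub by auto
    next
      assume "C \<in> insert v ` \<C>2"
      then obtain C' where C': "C' \<in> \<C>2" "C = insert v C'" by auto
      have "card C \<le> card C' + 1"
        unfolding C'(2) by (cases "finite C'") (auto simp: card_insert_if)
      then show ?thesis using C2(3)[OF C'(1)] d2 q1 C'(2) v(1) sub by auto
    qed
    moreover have "\<exists>C\<in>\<C>. I \<subseteq> C"
      if I: "I \<subseteq> U" "\<forall>u\<in>I. \<forall>v\<in>I. u \<noteq> v \<longrightarrow> \<not> adj u v" for I
    proof (cases "v \<in> I")
      case False
      then have "I \<subseteq> U1" using I by (auto simp: U1_def)
      then show ?thesis using C1(4)[of I] I(2) unfolding \<C>_def by auto
    next
      case True
      then have "I - {v} \<subseteq> U2" using I by (auto simp: U2_def U1_def N_def)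
      then obtain C where "C \<in> \<C>2" "I - {v} \<subseteq> C" using C2(4)[of "I - {v}"] I(2) by auto
      then show ?thesis unfolding \<C>_def by blast
    qed
    moreover have "finite \<C>" unfolding \<C>_def using C1 C2 by simp
    ultimately show ?thesis
      using card unfolding n_def q_def by (intro exI[of _ \<C>]) simp
  qed
qed

text \<open>Estimate the sum of the squared depths \<open>D x\<close> twice. The average depth is at
  least 2, so by Cauchy-Schwarz the sum is at least \<open>2 * card W * v\<close>. Counted as
  pairwise intersections, each \<open>u\<close> contributes \<open>v\<close> for itself and, if
  fewer than \<open>k\<close> others meet it, less than \<open>v\<close> for the rest, so the sum
  would fall below that bound.\<close>

lemma supersaturation:
  fixes B :: "'u \<Rightarrow> 'x set"
  assumes fin: "finite \<Omega>" "finite W" and "W \<noteq> {}" and "v > 0" and "k > 0"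
    and sub: "\<And>u. u \<in> W \<Longrightarrow> B u \<subseteq> \<Omega> \<and> card (B u) = v"
    and small: "\<And>u u'. u \<in> W \<Longrightarrow> u' \<in> W \<Longrightarrow> u \<noteq> u' \<Longrightarrow> k * card (B u \<inter> B u') \<le> v"
    and big: "2 * card \<Omega> \<le> card W * v"
  shows "\<exists>u\<in>W. k \<le> card {u'\<in>W. u' \<noteq> u \<and> B u \<inter> B u' \<noteq> {}}"
proof (rule ccontr)
  assume contra: "\<not> ?thesis"
  define D where "D x = card {u\<in>W. x \<in> B u}" for x
  \<comment> \<open>Sizes become sums of indicators over \<open>\<Omega>\<close>, so that double
    sums can be exchanged; \<open>X = UNIV\<close> gives the size of a single
    \<open>B u\<close>.\<close>
  have ind: "card (B u \<inter> X) = (\<Sum>x\<in>\<Omega>. if x \<in> B u \<and> x \<in> X then 1 else 0)" if "u \<in> W" for u X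
  proof -
    have "B u \<inter> X = {x\<in>\<Omega>. x \<in> B u \<and> x \<in> X}" using sub[OF that] by auto
    then show ?thesis using fin by (simp add: sum.If_cases Int_def)
  qed
  have D: "D x = (\<Sum>u\<in>W. if x \<in> B u then 1 else 0)" for x
    using fin by (simp add: D_def sum.If_cases Int_def)
  have sumD: "(\<Sum>x\<in>\<Omega>. D x) = card W * v"
  proof -
    have "(\<Sum>x\<in>\<Omega>. D x) = (\<Sum>u\<in>W. \<Sum>x\<in>\<Omega>. if x \<in> B u then 1 else 0)"
      unfolding D by (rule sum.swap)
    also have "\<dots> = (\<Sum>u\<in>W. v)"
      using ind[where X=UNIV] sub by (intro sum.cong) auto
    finally show ?thesis by simp
  qed
  have sumD2: "(\<Sum>x\<in>\<Omega>. (D x)\<^sup>2) = (\<Sum>u\<in>W. \<Sum>u'\<in>W. card (B u \<inter> B u'))"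
  proof -
    have "(\<Sum>u\<in>W. \<Sum>u'\<in>W. card (B u \<inter> B u'))
        = (\<Sum>u\<in>W. \<Sum>u'\<in>W. \<Sum>x\<in>\<Omega>. if x \<in> B u \<and> x \<in> B u' then 1 else 0)"
      using ind by (intro sum.cong) auto
    also have "\<dots> = (\<Sum>u\<in>W. \<Sum>x\<in>\<Omega>. \<Sum>u'\<in>W. if x \<in> B u \<and> x \<in> B u' then 1 else 0)"
      by (intro sum.cong refl sum.swap)
    also have "\<dots> = (\<Sum>x\<in>\<Omega>. \<Sum>u\<in>W. \<Sum>u'\<in>W. if x \<in> B u \<and> x \<in> B u' then 1 else 0)"
      by (rule sum.swap)
    also have "\<dots> = (\<Sum>x\<in>\<Omega>. (D x)\<^sup>2)"
      unfolding D power2_eq_square sum_product by (intro sum.cong refl) auto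
    finally show ?thesis by simp
  qed
  have upper: "(\<Sum>u'\<in>W. card (B u \<inter> B u')) < 2 * v" if u: "u \<in> W" for u
  proof -
    define Z where "Z = {u'\<in>W. u' \<noteq> u \<and> B u \<inter> B u' \<noteq> {}}"
    have "card Z < k" using contra u by (auto simp: Z_def not_le)
    have "(\<Sum>u'\<in>W. card (B u \<inter> B u')) = card (B u \<inter> B u) + (\<Sum>u'\<in>W-{u}. card (B u \<inter> B u'))"
      using fin u by (simp add: sum.remove)
    also have "(\<Sum>u'\<in>W-{u}. card (B u \<inter> B u')) = (\<Sum>u'\<in>Z. card (B u \<inter> B u'))"
      using fin by (intro sum.mono_neutral_right) (auto simp: Z_def)
    finally have *: "(\<Sum>u'\<in>W. card (B u \<inter> B u')) = v + (\<Sum>u'\<in>Z. card (B u \<inter> B u'))"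
      using sub[OF u] by simp
    have "k * (\<Sum>u'\<in>Z. card (B u \<inter> B u')) \<le> (\<Sum>u'\<in>Z. v)"
      unfolding sum_distrib_left using small u by (intro sum_mono) (auto simp: Z_def)
    also have "\<dots> < k * v" using \<open>card Z < k\<close> \<open>v > 0\<close> by simp
    finally show ?thesis using * by simp
  qed
  have lt: "(\<Sum>x\<in>\<Omega>. (D x)\<^sup>2) < card W * (2 * v)"
    unfolding sumD2 using sum_strict_mono[OF fin(2) \<open>W \<noteq> {}\<close> upper] by simp
  have "(\<Sum>x\<in>\<Omega>. D x)\<^sup>2 \<le> card \<Omega> * (\<Sum>x\<in>\<Omega>. (D x)\<^sup>2)"
  proof -
    have "(\<Sum>x\<in>\<Omega>. real (D x) * 1)\<^sup>2 \<le> (\<Sum>x\<in>\<Omega>. (real (D x))\<^sup>2) * (\<Sum>x\<in>\<Omega>. 1\<^sup>2)"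
      by (rule Cauchy_Schwarz_ineq_sum)
    then have "real ((\<Sum>x\<in>\<Omega>. D x)\<^sup>2) \<le> real (card \<Omega> * (\<Sum>x\<in>\<Omega>. (D x)\<^sup>2))"
      by (simp add: mult.commute)
    then show ?thesis by linarith
  qed
  then have "2 * (card W * v)\<^sup>2 \<le> (2 * card \<Omega>) * (\<Sum>x\<in>\<Omega>. (D x)\<^sup>2)"
    by (simp add: sumD)
  also have "\<dots> \<le> (card W * v) * (\<Sum>x\<in>\<Omega>. (D x)\<^sup>2)"
    using big by (intro mult_right_mono) auto
  also have "\<dots> < (card W * v) * (card W * (2 * v))"
    using lt fin \<open>W \<noteq> {}\<close> \<open>v > 0\<close> by (intro mult_strict_left_mono) (auto simp: card_gt_0_iff)
  finally show False by (simp add: power2_eq_square)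
qed

text \<open>First-moment method by counting: colour \<open>U\<close> at random with \<open>Q\<close>
  colours. A set \<open>T\<close> is monochromatic with probability at most
  \<open>Q / Q ^ card T\<close>, so some colouring leaves no member of \<open>\<T>\<close>
  monochromatic, and its largest class is \<open>A\<close>. Passing through a partition yields the
  density \<open>1 / Q\<close> without a concentration estimate.\<close>

lemma large_subset_avoiding:
  fixes \<T> :: "'u set set" and Q :: nat
  assumes "finite U" and "Q > 0" and "finite \<T>" and sub: "\<And>T. T \<in> \<T> \<Longrightarrow> T \<subseteq> U"
    and few: "(\<Sum>T\<in>\<T>. real Q / real Q ^ card T) < 1"
  shows "\<exists>A\<subseteq>U. card U \<le> card A * Q \<and> (\<forall>T\<in>\<T>. \<not> T \<subseteq> A)"
proof -
  define \<F> where "\<F> = U \<rightarrow>\<^sub>E {..<Q}"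
  define Bad where "Bad T c = {f\<in>\<F>. \<forall>u\<in>T. f u = c}" for T and c :: nat
  have finF: "finite \<F>" using assms by (auto simp: \<F>_def intro: finite_PiE)
  have cardF: "card \<F> = Q ^ card U" using assms by (simp add: \<F>_def card_PiE)
  have cardBad: "real (card (Bad T c)) * real Q ^ card T \<le> real Q ^ card U" if "T \<in> \<T>" "c < Q" for T c
  proof -
    \<comment> \<open>On \<open>T\<close> the colour is prescribed, elsewhere it is free.\<close>
    have "Bad T c \<subseteq> (\<Pi>\<^sub>E u\<in>U. if u \<in> T then {c} else {..<Q})"
      using that by (auto simp: Bad_def \<F>_def PiE_iff extensional_def)
    then have "card (Bad T c) \<le> card (\<Pi>\<^sub>E u\<in>U. if u \<in> T then {c} else {..<Q})"
      using assms by (intro card_mono finite_PiE) auto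
    also have "\<dots> = (\<Prod>u\<in>U. if u \<in> T then 1 else Q)"
      using assms(1) by (simp add: card_PiE if_distrib cong: if_cong)
    also have "\<dots> = Q ^ card (U - T)"
      using assms(1) by (simp add: prod.If_cases Diff_eq)
    finally have "card (Bad T c) * Q ^ card T \<le> Q ^ card (U - T) * Q ^ card T" by simp
    also have "\<dots> = Q ^ card U"
      using sub[OF that(1)] assms(1) card_mono[of U T]
      by (simp add: card_Diff_subset finite_subset flip: power_add)
    finally show ?thesis by (metis of_nat_le_iff of_nat_mult of_nat_power)
  qed
  have "real (card (\<Union>T\<in>\<T>. \<Union>c<Q. Bad T c)) \<le> (\<Sum>T\<in>\<T>. \<Sum>c<Q. real (card (Bad T c)))"
  proof -
    have "card (\<Union>T\<in>\<T>. \<Union>c<Q. Bad T c) \<le> (\<Sum>T\<in>\<T>. card (\<Union>c<Q. Bad T c))"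
      using assms by (intro card_UN_le) auto
    also have "\<dots> \<le> (\<Sum>T\<in>\<T>. \<Sum>c<Q. card (Bad T c))"
      by (intro sum_mono card_UN_le) auto
    finally show ?thesis by (metis (mono_tags, lifting) of_nat_le_iff of_nat_sum sum.cong)
  qed
  also have "\<dots> \<le> (\<Sum>T\<in>\<T>. \<Sum>c<Q. real Q ^ card U / real Q ^ card T)"
    using cardBad assms(2) by (intro sum_mono) (auto simp: field_simps)
  also have "\<dots> = real Q ^ card U * (\<Sum>T\<in>\<T>. real Q / real Q ^ card T)"
    by (simp add: sum_distrib_left mult_ac)
  also have "\<dots> < real (card \<F>)"
    using few assms(2) by (simp add: cardF)
  finally have "\<not> \<F> \<subseteq> (\<Union>T\<in>\<T>. \<Union>c<Q. Bad T c)"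
    using card_mono[of "\<Union>T\<in>\<T>. \<Union>c<Q. Bad T c" \<F>] assms(3) finF
    by (auto simp: Bad_def)
  then obtain f where f: "f \<in> \<F>" "\<And>T c. T \<in> \<T> \<Longrightarrow> c < Q \<Longrightarrow> f \<notin> Bad T c" by blast
  define A where "A c = {u\<in>U. f u = c}" for c
  have "card U = (\<Sum>c<Q. card (A c))"
  proof -
    have "U = (\<Union>c<Q. A c)" using f(1) by (auto simp: A_def \<F>_def PiE_iff)
    also have "card \<dots> = (\<Sum>c<Q. card (A c))"
      using assms(1) by (intro card_UN_disjoint) (auto simp: A_def)
    finally show ?thesis .
  qed
  moreover have "\<exists>c<Q. card U \<le> card (A c) * Q"
  proof (rule ccontr)
    assume "\<not> ?thesis"
    then have "(\<Sum>c<Q. card (A c) * Q) < (\<Sum>c<Q. card U)"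
      using \<open>Q > 0\<close> by (intro sum_strict_mono) auto
    then show False using \<open>card U = _\<close> by (simp flip: sum_distrib_right)
  qed
  then obtain c where c: "c < Q" "card U \<le> card (A c) * Q" by blast
  moreover have "\<not> T \<subseteq> A c" if "T \<in> \<T>" for T
    using f(2)[OF that c(1)] f(1) by (auto simp: Bad_def A_def)
  ultimately show ?thesis by (intro exI[of _ "A c"]) (auto simp: A_def)
qed

text \<open>Forbidden are the \<open>t\<close>-sets of boxes through one point (\<open>T1\<close>)
  and the \<open>s\<close>-sets inside one container (\<open>T2\<close>); each kind takes at most
  1/4 of the first-moment budget. Since \<open>card \<Omega> = R * v\<close>, supersaturation
  applies to any \<open>2 * R\<close> boxes, and containers have at most \<open>3 * R\<close>
  members. An independent subset of \<open>A\<close> with \<open>s\<close> or more members would lie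
  in a container and so include a member of \<open>T2\<close>.\<close>

lemma sparse_subfamily:
  fixes B :: "'u \<Rightarrow> 'x set"
  assumes fin: "finite \<Omega>" "finite U" and pos: "Q > 0" "k > 0" "v > 0" "R > 0"
    and sub: "\<And>u. u \<in> U \<Longrightarrow> B u \<subseteq> \<Omega> \<and> card (B u) = v"
    and small: "\<And>u u'. u \<in> U \<Longrightarrow> u' \<in> U \<Longrightarrow> u \<noteq> u' \<Longrightarrow> k * card (B u \<inter> B u') \<le> v"
    and depth: "\<And>x. x \<in> \<Omega> \<Longrightarrow> card {u\<in>U. x \<in> B u} \<le> S"
    and vol: "card \<Omega> = R * v" and quot: "card U div k \<le> R"
    and num_depth: "4 * card \<Omega> * S ^ t * Q \<le> Q ^ t"
    and num_indep: "4 * (card U + 1) ^ (card U div k) * (3 * R choose s) * Q \<le> Q ^ s"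
  shows "\<exists>A\<subseteq>U. card U \<le> card A * Q \<and> (\<forall>x\<in>\<Omega>. card {u\<in>A. x \<in> B u} < t) \<and>
    (\<forall>I\<subseteq>A. (\<forall>u\<in>I. \<forall>u'\<in>I. u \<noteq> u' \<longrightarrow> B u \<inter> B u' = {}) \<longrightarrow> card I < s)"
proof -
  have "\<exists>u\<in>W. k \<le> card {u'\<in>W. u' \<noteq> u \<and> B u \<inter> B u' \<noteq> {}}" if "W \<subseteq> U" "2 * R \<le> card W" for W
  proof (rule supersaturation[of \<Omega> W v k B])
    show "finite W" using fin(2) that(1) by (rule rev_finite_subset)
    show "W \<noteq> {}" using that(2) pos by auto
    show "2 * card \<Omega> \<le> card W * v" using that(2) by (simp add: vol)
    show "B u \<subseteq> \<Omega> \<and> card (B u) = v" if "u \<in> W" for u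
      using sub that \<open>W \<subseteq> U\<close> by blast
    show "k * card (B u \<inter> B u') \<le> v" if "u \<in> W" "u' \<in> W" "u \<noteq> u'" for u u'
      using small that \<open>W \<subseteq> U\<close> by blast
  qed (use fin pos in auto)
  then have "\<exists>\<C>. finite \<C> \<and> card \<C> \<le> (card U + 1) ^ (card U div k) \<and>
    (\<forall>C\<in>\<C>. C \<subseteq> U \<and> card C \<le> 2 * R + card U div k) \<and>
    (\<forall>I\<subseteq>U. (\<forall>u\<in>I. \<forall>u'\<in>I. u \<noteq> u' \<longrightarrow> \<not> B u \<inter> B u' \<noteq> {}) \<longrightarrow> (\<exists>C\<in>\<C>. I \<subseteq> C))"
    using fin pos by (intro containers_exist) auto
  then obtain \<C> where C: "finite \<C>" "card \<C> \<le> (card U + 1) ^ (card U div k)"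
    "\<forall>C\<in>\<C>. C \<subseteq> U \<and> card C \<le> 2 * R + card U div k"
    "\<forall>I\<subseteq>U. (\<forall>u\<in>I. \<forall>u'\<in>I. u \<noteq> u' \<longrightarrow> \<not> B u \<inter> B u' \<noteq> {}) \<longrightarrow> (\<exists>C\<in>\<C>. I \<subseteq> C)"
    by (elim exE conjE)
  define T1 where "T1 = (\<Union>x\<in>\<Omega>. {T. T \<subseteq> {u\<in>U. x \<in> B u} \<and> card T = t})"
  define T2 where "T2 = (\<Union>C\<in>\<C>. {T. T \<subseteq> C \<and> card T = s})"
  have finC: "finite C" if "C \<in> \<C>" for C using C(3) that fin(2) by (auto intro: finite_subset)
  have finT: "finite T1" "finite T2"
    using fin C(1) finC by (auto simp: T1_def T2_def intro!: finite_subset[OF _ finite_Collect_subsets])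
  have "card T1 \<le> (\<Sum>x\<in>\<Omega>. card {T. T \<subseteq> {u\<in>U. x \<in> B u} \<and> card T = t})"
    unfolding T1_def using fin(1) by (rule card_UN_le)
  also have "\<dots> \<le> (\<Sum>x\<in>\<Omega>. S ^ t)"
  proof (rule sum_mono)
    fix x assume "x \<in> \<Omega>"
    have "card {T. T \<subseteq> {u\<in>U. x \<in> B u} \<and> card T = t} = card {u\<in>U. x \<in> B u} choose t"
      using fin by (intro n_subsets) auto
    also have "\<dots> \<le> S choose t" using depth[OF \<open>x \<in> \<Omega>\<close>] by (rule binomial_right_mono)
    also have "\<dots> \<le> S ^ t"
      by (cases "t \<le> S") (auto simp: binomial_le_pow binomial_eq_0)
    finally show "card {T. T \<subseteq> {u\<in>U. x \<in> B u} \<and> card T = t} \<le> S ^ t" .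
  qed
  finally have T1: "card T1 \<le> card \<Omega> * S ^ t" by simp
  have "card T2 \<le> (\<Sum>C\<in>\<C>. card {T. T \<subseteq> C \<and> card T = s})"
    unfolding T2_def using C(1) by (rule card_UN_le)
  also have "\<dots> \<le> (\<Sum>C\<in>\<C>. 3 * R choose s)"
  proof (rule sum_mono)
    fix C' assume C': "C' \<in> \<C>"
    have "card {T. T \<subseteq> C' \<and> card T = s} = card C' choose s"
      using finC[OF C'] by (intro n_subsets) auto
    also have "\<dots> \<le> 3 * R choose s" using C(3) C' quot by (intro binomial_right_mono) force
    finally show "card {T. T \<subseteq> C' \<and> card T = s} \<le> 3 * R choose s" .
  qed
  also have "\<dots> \<le> (card U + 1) ^ (card U div k) * (3 * R choose s)"
    using C(2) by simp
  finally have T2: "card T2 \<le> (card U + 1) ^ (card U div k) * (3 * R choose s)" .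
  have "(\<Sum>T\<in>T1 \<union> T2. real Q / real Q ^ card T) \<le>
      (\<Sum>T\<in>T1. real Q / real Q ^ card T) + (\<Sum>T\<in>T2. real Q / real Q ^ card T)"
    using finT by (subst sum_Un) (auto intro!: sum_nonneg)
  also have "(\<Sum>T\<in>T1. real Q / real Q ^ card T) = (\<Sum>T\<in>T1. real Q / real Q ^ t)"
    by (intro sum.cong) (auto simp: T1_def)
  also have "\<dots> = real (card T1 * Q) / real Q ^ t" by simp
  also have "\<dots> \<le> real (card \<Omega> * S ^ t * Q) / real Q ^ t"
    using T1 by (intro divide_right_mono of_nat_mono mult_right_mono) auto
  also have "\<dots> \<le> 1 / 4"
  proof -
    have "real (4 * card \<Omega> * S ^ t * Q) \<le> real (Q ^ t)" using num_depth by (rule of_nat_mono)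
    then show ?thesis using pos by (simp add: field_simps)
  qed
  also have "(\<Sum>T\<in>T2. real Q / real Q ^ card T) = (\<Sum>T\<in>T2. real Q / real Q ^ s)"
    by (intro sum.cong) (auto simp: T2_def)
  also have "\<dots> = real (card T2 * Q) / real Q ^ s" by simp
  also have "\<dots> \<le> real ((card U + 1) ^ (card U div k) * (3 * R choose s) * Q) / real Q ^ s"
    using T2 by (intro divide_right_mono of_nat_mono mult_right_mono) auto
  also have "\<dots> \<le> 1 / 4"
  proof -
    have "real (4 * (card U + 1) ^ (card U div k) * (3 * R choose s) * Q) \<le> real (Q ^ s)"
      using num_indep by (rule of_nat_mono)
    then show ?thesis using pos by (simp add: field_simps)
  qed
  finally have sum: "(\<Sum>T\<in>T1 \<union> T2. real Q / real Q ^ card T) < 1" by simp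
  have "T \<subseteq> U" if "T \<in> T1 \<union> T2" for T using that C(3) by (auto simp: T1_def T2_def)
  then have "\<exists>A\<subseteq>U. card U \<le> card A * Q \<and> (\<forall>T\<in>T1 \<union> T2. \<not> T \<subseteq> A)"
    using fin finT pos sum by (intro large_subset_avoiding) auto
  then obtain A where A: "A \<subseteq> U" "card U \<le> card A * Q" "\<And>T. T \<in> T1 \<union> T2 \<Longrightarrow> \<not> T \<subseteq> A" by blast
  have "card {u\<in>A. x \<in> B u} < t" if "x \<in> \<Omega>" for x
  proof (rule ccontr)
    assume "\<not> ?thesis"
    then obtain T where T: "T \<subseteq> {u\<in>A. x \<in> B u}" "card T = t"
      by (meson not_less obtain_subset_with_card_n)
    then have "T \<in> T1" using A(1) that unfolding T1_def by blast
    then show False using A(3) T by blast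
  qed
  moreover have "card I < s" if I: "I \<subseteq> A" "\<forall>u\<in>I. \<forall>u'\<in>I. u \<noteq> u' \<longrightarrow> B u \<inter> B u' = {}" for I
  proof (rule ccontr)
    assume "\<not> ?thesis"
    then obtain T where T: "T \<subseteq> I" "card T = s"
      by (meson not_less obtain_subset_with_card_n)
    obtain C' where "C' \<in> \<C>" "I \<subseteq> C'" using C(4) I A(1) by (metis order_trans)
    then have "T \<in> T2" using T unfolding T2_def by blast
    then show False using A(3) T I by blast
  qed
  ultimately show ?thesis using A by blast
qed

text \<open>Why the parameters fit: \<open>(S / Q)\<^bsup>t\<^esup> = l\<^bsup>-t\<^esup>\<close> must beat the number \<open>k\<^bsup>d m\<^esup>\<close> of grid points, and the
  \<open>(N + 1)\<^bsup>N div k\<^esup>\<close> containers must number at most \<open>2\<^bsup>R / Q\<^esup>\<close>, which forces \<open>k \<ge> S Q log\<^sub>2 (N + 1)\<close>;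
  the exponent \<open>2 d + 2\<close> leaves \<open>l\<^bsup>3\<^esup>\<close> for the logarithm.\<close>

lemma parameter_bounds:
  fixes d l :: nat
  assumes d: "d \<ge> 2" and l: "l \<ge> 2 * d\<^sup>2"
  defines "k \<equiv> l ^ (2 * d + 2)" and "m \<equiv> (d - 1) * l"
  defines "R \<equiv> k ^ m" and "S \<equiv> l ^ (d - 1)" and "Q \<equiv> l ^ d"
  defines "N \<equiv> S * R" and "t \<equiv> 2 * d ^ 3 * l" and "s \<equiv> 12 * (R div Q)"
  shows "4 * k ^ (d * m) * S ^ t * Q \<le> Q ^ t" and "N div k \<le> R"
    and "4 * (N + 1) ^ (N div k) * (3 * R choose s) * Q \<le> Q ^ s"
    and "N \<le> l ^ (2 * d\<^sup>2 * l)" and "Q * s = 12 * R"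
proof -
  have "2 * 2\<^sup>2 \<le> 2 * d\<^sup>2" using d by (intro mult_left_mono power_mono) auto
  then have l8: "l \<ge> 8" using l by simp
  have "d * 1 \<le> d * d" using d by (intro mult_left_mono) auto
  then have ld: "l \<ge> 2 * d" using l unfolding power2_eq_square by linarith
  obtain e where e: "d = Suc e" "e \<ge> 1" using d by (cases d) auto
  \<comment> \<open>\<open>z\<close> is the exponent in \<open>R = l ^ z\<close>. The main
    quantities are powers of \<open>l\<close>, so most comparisons reduce to exponents.\<close>
  define z where "z = (2 * d + 2) * m"
  have z: "z = 2 * (d\<^sup>2 - 1) * l"
    unfolding z_def m_def e by (simp add: power2_eq_square algebra_simps)
  have d2: "d\<^sup>2 \<ge> 4" using d power_mono[of 2 d 2] by simp
  have zbig: "z \<ge> 6 * l" using d2 unfolding z by (intro mult_right_mono) auto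
  have R: "R = l ^ z" unfolding R_def k_def z_def by (rule power_mult[symmetric])
  \<comment> \<open>\<open>Y\<close> is the exact quotient of \<open>R\<close> by \<open>Q\<close>,
    so \<open>s = 12 * Y\<close>.\<close>
  define Y where "Y = l ^ (z - d)"
  have zd: "z \<ge> 2 * d + 3" using zbig l8 ld by linarith
  have RQ: "R = Q * Y" unfolding R Q_def Y_def using zd by (simp flip: power_add)
  have lpos: "l > 0" "Q > 0" "k > 0" using l8 by (auto simp: Q_def k_def)
  have s: "s = 12 * Y" using lpos by (simp add: s_def RQ)
  show Qs: "Q * s = 12 * R" by (simp add: s RQ)
  have Nk: "N div k = l ^ (z - d - 3)"
  proof -
    have "N = k * l ^ (z - d - 3)"
    proof -
      have "d - 1 + z = 2 * d + 2 + (z - d - 3)" using zd d by simp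
      then show ?thesis unfolding N_def S_def R k_def by (simp only: flip: power_add)
    qed
    then show ?thesis using lpos by simp
  qed
  show "N div k \<le> R" unfolding Nk R using l8 by (intro power_increasing) auto
  \<comment> \<open>One factor \<open>l \<ge> 2\<close> absorbs the \<open>+ 1\<close>; the
    exponents compare because \<open>2 * d\<^sup>2 * l = z + 2 * l\<close> and
    \<open>d \<le> 2 * l\<close>.\<close>
  have N1: "N + 1 \<le> l ^ (2 * d\<^sup>2 * l)"
  proof -
    have "N = l ^ (d - 1 + z)" by (simp add: N_def S_def R power_add)
    moreover have "1 \<le> l ^ (d - 1 + z)" using l8 by simp
    ultimately have "N + 1 \<le> 2 * l ^ (d - 1 + z)" by simp
    also have "\<dots> \<le> l * l ^ (d - 1 + z)" using l8 by simp
    also have "\<dots> = l ^ (d + z)" using d by (simp flip: power_Suc)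
    also have "\<dots> \<le> l ^ (2 * d\<^sup>2 * l)"
    proof (intro power_increasing)
      have "2 * d\<^sup>2 * l = z + 2 * l"
        using d2 unfolding z by (cases "d\<^sup>2") (simp_all add: algebra_simps)
      then show "d + z \<le> 2 * d\<^sup>2 * l" using ld by simp
    qed (use l8 in auto)
    finally show ?thesis .
  qed
  then show "N \<le> l ^ (2 * d\<^sup>2 * l)" by simp
  show "4 * k ^ (d * m) * S ^ t * Q \<le> Q ^ t"
  proof -
    \<comment> \<open>As \<open>Q = l * S\<close>, the factor \<open>S ^ t\<close> cancels. What
      remains has exponent at most \<open>d * z + d + 1\<close>, and \<open>t\<close> is exactly
      \<open>d * z + 2 * d * l\<close>.\<close>
    have Qt: "Q ^ t = l ^ t * S ^ t"
      unfolding Q_def S_def e by (simp add: power_mult_distrib)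
    have kd: "k ^ (d * m) = l ^ (d * z)"
      unfolding k_def z_def power_mult[symmetric] by (metis mult.left_commute)
    have "4 * k ^ (d * m) * Q \<le> l * k ^ (d * m) * Q" using l8 by (intro mult_right_mono) auto
    also have "\<dots> = l ^ (d * z + d + 1)" unfolding kd Q_def by (simp add: power_add)
    also have "\<dots> \<le> l ^ t"
    proof (intro power_increasing)
      have "d * z + 2 * d * l = 2 * d * ((d\<^sup>2 - 1) * l + l)"
        unfolding z by (simp only: distrib_left mult_ac)
      also have "(d\<^sup>2 - 1) * l + l = d\<^sup>2 * l" using d2 by (simp add: diff_mult_distrib)
      also have "2 * d * (d\<^sup>2 * l) = t" by (simp add: t_def power2_eq_square power3_eq_cube)
      finally have "d * z + 2 * d * l = t" .
      moreover have "2 * d * 1 \<le> 2 * d * l" using l8 by (intro mult_left_mono) auto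
      ultimately show "d * z + d + 1 \<le> t" using d by linarith
    qed (use l8 in auto)
    finally have "4 * k ^ (d * m) * Q * S ^ t \<le> l ^ t * S ^ t" by simp
    then show ?thesis by (simp add: Qt mult_ac)
  qed
  have pow2: "(N + 1) ^ (N div k) \<le> 2 ^ Y"
  proof -
    \<comment> \<open>The crude bound \<open>l \<le> 2 ^ l\<close> suffices: with
      \<open>2 * d\<^sup>2 \<le> l\<close> the exponent of 2 is at most
      \<open>l ^ 3\<close>.\<close>
    have "l ^ (2 * d\<^sup>2 * l) \<le> (2 ^ l) ^ (2 * d\<^sup>2 * l)"
      by (intro power_mono) auto
    also have "\<dots> = 2 ^ (l * (2 * d\<^sup>2 * l))" by (simp flip: power_mult)
    also have "\<dots> \<le> 2 ^ (l ^ 3)"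
      using l by (intro power_increasing) (auto simp: power3_eq_cube)
    finally have "N + 1 \<le> 2 ^ (l ^ 3)" using N1 by simp
    then have "(N + 1) ^ (N div k) \<le> (2 ^ (l ^ 3)) ^ (N div k)" by (intro power_mono) auto
    also have "\<dots> = 2 ^ (l ^ 3 * l ^ (z - d - 3))" by (simp add: Nk flip: power_mult)
    also have "l ^ 3 * l ^ (z - d - 3) = Y" unfolding Y_def using zd by (simp flip: power_add)
    finally show ?thesis .
  qed
  have choose: "real (3 * R choose s) * 2 ^ (3 * Y) \<le> real Q ^ s"
  proof -
    \<comment> \<open>The binomial coefficient is bounded through one term of the expansion of
      \<open>(w + 1) ^ (3 * R)\<close>. For \<open>w = 2 / Q\<close> the whole sum is at most
      \<open>exp (6 * Y)\<close>, hence at most \<open>2 ^ (9 * Y)\<close>; as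
      \<open>s = 12 * Y\<close>, a factor \<open>2 ^ (3 * Y)\<close> is left over.\<close>
    define w :: real where "w = 2 / real Q"
    have w: "w \<ge> 0" by (simp add: w_def)
    have "real (3 * R choose s) * w ^ s \<le> (\<Sum>i\<le>3 * R. real (3 * R choose i) * w ^ i)"
    proof (cases "s \<le> 3 * R")
      case True
      then show ?thesis using w by (intro member_le_sum) auto
    qed (use w in \<open>auto simp: binomial_eq_0 intro!: sum_nonneg\<close>)
    also have "\<dots> = (w + 1) ^ (3 * R)" by (subst binomial_ring) simp
    also have "\<dots> \<le> exp w ^ (3 * R)"
      using w exp_ge_add_one_self[of w] by (intro power_mono) (auto simp: add.commute)
    also have "\<dots> = exp (real (3 * R) * w)" by (rule exp_of_nat_mult[symmetric])
    also have "real (3 * R) * w = real Y * 6" using lpos by (simp add: w_def RQ)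
    also have "exp (real Y * 6) = exp 6 ^ Y" by (rule exp_of_nat_mult)
    also have "\<dots> \<le> (2 ^ 9) ^ Y"
    proof (intro power_mono)
      have "exp (1::real) \<le> 272 / 100" using e_less_272 by simp
      then have "exp (1::real) ^ 6 \<le> (272 / 100) ^ 6" by (intro power_mono) auto
      also have "\<dots> \<le> 2 ^ 9" by (simp add: power_divide)
      finally show "exp (6::real) \<le> 2 ^ 9" using exp_of_nat_mult[of 6 "1::real"] by simp
    qed auto
    also have "\<dots> = 2 ^ (9 * Y)" by (simp add: power_mult)
    finally have "real (3 * R choose s) * 2 ^ s \<le> 2 ^ (9 * Y) * real Q ^ s"
      using lpos by (simp add: w_def power_divide field_simps)
    moreover have "(2::real) ^ s = 2 ^ (9 * Y) * 2 ^ (3 * Y)"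
      by (simp add: s flip: power_add)
    ultimately have "2 ^ (9 * Y) * (real (3 * R choose s) * 2 ^ (3 * Y)) \<le> 2 ^ (9 * Y) * real Q ^ s"
      by (simp add: mult_ac)
    then show ?thesis by (rule mult_left_le_imp_le) simp
  qed
  have "(3 * R choose s) * 2 ^ (3 * Y) \<le> Q ^ s"
    using choose by (metis (mono_tags, lifting) of_nat_le_iff of_nat_mult of_nat_numeral of_nat_power)
  have QY: "Q \<le> Y" unfolding Q_def Y_def using zd zbig l8 ld by (intro power_increasing) auto
  then have Q2: "Q \<le> 2 ^ Y" using less_exp[of Y] by linarith
  have "8 \<le> l ^ 1" using l8 by simp
  also have "\<dots> \<le> Q" unfolding Q_def using d l8 by (intro power_increasing) auto
  finally have "(2::nat) ^ 2 \<le> 2 ^ Y" using QY by (intro power_increasing) auto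
  then have four: "4 \<le> (2::nat) ^ Y" by simp
  \<comment> \<open>The leftover \<open>2 ^ (3 * Y)\<close> pays for the factor 4, the containers
    and \<open>Q\<close>, each at most \<open>2 ^ Y\<close>.\<close>
  have "4 * (N + 1) ^ (N div k) * (3 * R choose s) * Q \<le> 2 ^ Y * 2 ^ Y * (3 * R choose s) * 2 ^ Y"
    using four pow2 Q2 by (intro mult_mono) auto
  also have "\<dots> = (3 * R choose s) * 2 ^ (3 * Y)"
    by (simp add: power_add eval_nat_numeral)
  also have "\<dots> \<le> Q ^ s" by fact
  finally show "4 * (N + 1) ^ (N div k) * (3 * R choose s) * Q \<le> Q ^ s" .
qed

section \<open>Grid boxes of equal volume\<close>

lemma atLeastAtMost_fun_eq_PiE:
  fixes a b :: "'d::finite \<Rightarrow> nat"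
  shows "{a..b} = (\<Pi>\<^sub>E i\<in>UNIV. {a i..b i})"
  by (auto simp: le_fun_def PiE_iff)

lemma card_atLeastAtMost_fun:
  fixes a b :: "'d::finite \<Rightarrow> nat"
  shows "card {a..b} = (\<Prod>i\<in>UNIV. Suc (b i) - a i)"
  unfolding atLeastAtMost_fun_eq_PiE by (simp add: card_PiE)

lemma atLeastAtMost_fun_Int:
  fixes a b :: "'d::finite \<Rightarrow> nat"
  shows "{a..b} \<inter> {a'..b'} = (\<Pi>\<^sub>E i\<in>UNIV. {a i..b i} \<inter> {a' i..b' i})"
  by (auto simp: le_fun_def PiE_iff)

text \<open>Equality would force both vectors to coincide with their pointwise minimum. Strictness
  is what gains the factor \<open>k\<close> for boxes of different shapes.\<close>

lemma sum_min_less_sum: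
  fixes b b' :: "'d::finite \<Rightarrow> nat"
  assumes "sum b UNIV = sum b' UNIV" "b \<noteq> b'"
  shows "(\<Sum>i\<in>UNIV. min (b i) (b' i)) < sum b UNIV"
proof (rule ccontr)
  assume "\<not> ?thesis"
  moreover have "(\<Sum>i\<in>UNIV. min (b i) (b' i)) \<le> sum b UNIV" by (intro sum_mono) auto
  ultimately have *: "(\<Sum>i\<in>UNIV. min (b i) (b' i)) = sum b UNIV" by simp
  have "b i = min (b i) (b' i)" for i
    using * by (subst (asm) eq_commute, intro sum_mono_inv[where I=UNIV and f="\<lambda>i. min (b i) (b' i)", symmetric]) auto
  moreover have "b' i = min (b i) (b' i)" for i
    using * assms(1)
    by (intro sum_mono_inv[where I=UNIV and f="\<lambda>i. min (b i) (b' i)", symmetric]) auto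
  ultimately show False using assms(2) by (metis ext)
qed

text \<open>A pair \<open>p = (b, j)\<close> names a box of the \<open>k\<close>-adic grid:
  \<open>b\<close> is its shape, with side \<open>k ^ b i\<close> in direction \<open>i\<close>, and
  \<open>j\<close> is its position among the boxes of that shape.\<close>

definition grid_lo :: "nat \<Rightarrow> ('d \<Rightarrow> nat) \<times> ('d \<Rightarrow> nat) \<Rightarrow> 'd \<Rightarrow> nat" where
  "grid_lo k p = (\<lambda>i. snd p i * k ^ fst p i)"

text \<open>The \<open>- 1\<close> closes the interval over the integers, so that adjacent boxes of
  one shape do not share points.\<close>

definition grid_hi :: "nat \<Rightarrow> ('d \<Rightarrow> nat) \<times> ('d \<Rightarrow> nat) \<Rightarrow> 'd \<Rightarrow> nat" where
  "grid_hi k p = (\<lambda>i. Suc (snd p i) * k ^ fst p i - 1)"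

abbreviation grid_box :: "nat \<Rightarrow> ('d \<Rightarrow> nat) \<times> ('d \<Rightarrow> nat) \<Rightarrow> ('d \<Rightarrow> nat) set" where
  "grid_box k p \<equiv> {grid_lo k p..grid_hi k p}"

text \<open>For a fixed shape, any point of a box determines its position as a vector of quotients.
  Hence boxes of one shape are disjoint, and a point lies in at most one box per shape.\<close>

lemma mem_grid_box:
  assumes "k > 0"
  shows "x \<in> grid_box k (b, j) \<longleftrightarrow> (\<forall>i. x i div k ^ b i = j i)"
proof -
  have "(j i * k ^ b i \<le> x i \<and> x i \<le> Suc (j i) * k ^ b i - 1) \<longleftrightarrow> x i div k ^ b i = j i" for i
  proof -
    have "k ^ b i > 0" using assms by simp
    have "x i div k ^ b i = j i \<longleftrightarrow> j i \<le> x i div k ^ b i \<and> x i div k ^ b i < Suc (j i)"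
      by auto
    also have "\<dots> \<longleftrightarrow> j i * k ^ b i \<le> x i \<and> x i < Suc (j i) * k ^ b i"
      using \<open>k ^ b i > 0\<close> by (simp only: less_eq_div_iff_mult_less_eq div_less_iff_less_mult)
    also have "x i < Suc (j i) * k ^ b i \<longleftrightarrow> x i \<le> Suc (j i) * k ^ b i - 1"
    proof -
      have "0 < Suc (j i) * k ^ b i" using \<open>k ^ b i > 0\<close> by simp
      then show ?thesis by linarith
    qed
    finally show ?thesis by simp
  qed
  then show ?thesis by (auto simp: grid_lo_def grid_hi_def le_fun_def)
qed

lemma card_grid_box:
  fixes b j :: "'d::finite \<Rightarrow> nat"
  assumes "k > 0"
  shows "card (grid_box k (b, j)) = k ^ sum b UNIV"
proof -
  have "Suc (Suc (j i) * k ^ b i - 1) - j i * k ^ b i = k ^ b i" for i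
    using assms by (simp add: Suc_diff_1)
  then show ?thesis
    unfolding card_atLeastAtMost_fun by (simp add: grid_lo_def grid_hi_def power_sum)
qed

text \<open>Boxes of one shape are disjoint. For different shapes the intersection has at most
  \<open>k ^ min (b i) (b' i)\<close> values in direction \<open>i\<close>, and these minima add up
  to at least one less than the common exponent sum.\<close>

lemma card_grid_box_Int:
  fixes b j :: "'d::finite \<Rightarrow> nat"
  assumes "k > 0" and sum: "sum b UNIV = sum b' UNIV" and ne: "(b, j) \<noteq> (b', j')"
  shows "k * card (grid_box k (b, j) \<inter> grid_box k (b', j')) \<le> k ^ sum b UNIV"
proof (cases "b = b'")
  case True
  then have "j \<noteq> j'" using ne by simp
  then have "grid_box k (b, j) \<inter> grid_box k (b', j') = {}"
    using mem_grid_box[OF assms(1), of _ b j] mem_grid_box[OF assms(1), of _ b j']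
    unfolding True[symmetric] by (metis disjoint_iff ext)
  then show ?thesis by simp
next
  case False
  have "card ({grid_lo k (b, j) i..grid_hi k (b, j) i} \<inter> {grid_lo k (b', j') i..grid_hi k (b', j') i})
      \<le> k ^ min (b i) (b' i)" (is "card (?X \<inter> ?Y) \<le> _") for i
  proof -
    have "card ?X = k ^ b i" "card ?Y = k ^ b' i"
      using assms(1) by (simp_all add: grid_lo_def grid_hi_def Suc_diff_1)
    moreover have "card (?X \<inter> ?Y) \<le> card ?X" "card (?X \<inter> ?Y) \<le> card ?Y"
      by (intro card_mono; simp)+
    ultimately show ?thesis by (simp add: min_def)
  qed
  then have "card (grid_box k (b, j) \<inter> grid_box k (b', j')) \<le> (\<Prod>i\<in>UNIV. k ^ min (b i) (b' i))"
    unfolding atLeastAtMost_fun_Int by (simp add: card_PiE prod_mono)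
  also have "\<dots> = k ^ (\<Sum>i\<in>UNIV. min (b i) (b' i))" by (rule power_sum[symmetric])
  finally have "k * card (grid_box k (b, j) \<inter> grid_box k (b', j'))
      \<le> k * k ^ (\<Sum>i\<in>UNIV. min (b i) (b' i))" by simp
  also have "\<dots> = k ^ Suc (\<Sum>i\<in>UNIV. min (b i) (b' i))" by simp
  also have "\<dots> \<le> k ^ sum b UNIV"
    using sum_min_less_sum[OF sum False] assms(1) by (intro power_increasing) auto
  finally show ?thesis .
qed

text \<open>In every direction except \<open>i0\<close> the exponent is \<open>m - a i\<close> with
  \<open>a i < l\<close> free; direction \<open>i0\<close> takes the sum of the \<open>a i\<close>
  and restores the total. The value of \<open>m\<close> is what keeps that exponent within
  \<open>m\<close>.\<close>

lemma equal_volume_shapes_exist: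
  fixes l m :: nat
  assumes "CARD('d::finite) \<ge> 2" and m: "m = (CARD('d) - 1) * l" and "l > 0"
  shows "\<exists>Sh :: ('d \<Rightarrow> nat) set. finite Sh \<and> card Sh = l ^ (CARD('d) - 1) \<and>
    (\<forall>b\<in>Sh. (\<forall>i. b i \<le> m) \<and> sum b UNIV = (CARD('d) - 1) * m)"
proof -
  fix i0 :: 'd
  define J where "J = UNIV - {i0}"
  have J: "finite J" "card J = CARD('d) - 1" by (auto simp: J_def card_Diff_singleton)
  define g :: "('d \<Rightarrow> nat) \<Rightarrow> 'd \<Rightarrow> nat" where
    "g a = (\<lambda>i. if i = i0 then sum a J else m - a i)" for a
  define D where "D = J \<rightarrow>\<^sub>E {..<l}"
  have lm: "l \<le> m" using assms by (cases "CARD('d) - 1") auto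
  have small: "a i \<le> m" if "a \<in> D" "i \<in> J" for a i
    using that lm by (force simp: D_def PiE_iff)
  have sumJ: "sum a J \<le> m" if "a \<in> D" for a
  proof -
    have "sum a J \<le> (\<Sum>i\<in>J. l)" using that by (intro sum_mono) (force simp: D_def PiE_iff)
    then show ?thesis using J m by simp
  qed
  \<comment> \<open>\<open>a\<close> is read off outside \<open>i0\<close>; the subtraction is not
    truncated because \<open>a i \<le> m\<close>.\<close>
  have inj: "inj_on g D"
  proof (rule inj_onI)
    fix a a' assume a: "a \<in> D" "a' \<in> D" "g a = g a'"
    show "a = a'"
    proof (rule PiE_ext)
      fix i assume i: "i \<in> J"
      have "m - a i = m - a' i" using fun_cong[OF a(3), of i] i by (auto simp: g_def J_def)
      then show "a i = a' i" using small[OF a(1) i] small[OF a(2) i] by simp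
    qed (use a in \<open>simp_all add: D_def\<close>)
  qed
  have "sum (g a) UNIV = (CARD('d) - 1) * m" if "a \<in> D" for a
  proof -
    have "sum (g a) UNIV = g a i0 + sum (g a) J" unfolding J_def by (rule sum.remove) auto
    also have "sum (g a) J = (\<Sum>i\<in>J. m - a i)" by (intro sum.cong) (auto simp: g_def J_def)
    also have "g a i0 + \<dots> = (\<Sum>i\<in>J. a i + (m - a i))" by (simp add: g_def sum.distrib)
    also have "\<dots> = (\<Sum>i\<in>J. m)" using small[OF that] by (intro sum.cong) auto
    finally show ?thesis using J by simp
  qed
  moreover have "g a i \<le> m" if "a \<in> D" for a i using sumJ[OF that] by (simp add: g_def)
  moreover have "finite D" unfolding D_def using J by (intro finite_PiE) auto
  moreover have "card (g ` D) = l ^ (CARD('d) - 1)"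
    using card_image[OF inj] J by (simp add: D_def card_PiE)
  ultimately show ?thesis by (intro exI[of _ "g ` D"]) auto
qed

text \<open>This applies the sparsification to the grid. The inequality between \<open>s\<close> and
  \<open>card A\<close> says that an independent set is at most a \<open>12 / S\<close> fraction of
  \<open>A\<close>, where \<open>S\<close> counts the shapes. Corners are integral because the later
  enlargement of the boxes relies on it.\<close>

lemma sparse_integer_boxes:
  fixes l :: nat
  assumes d: "CARD('d::finite) \<ge> 2" and l: "l \<ge> 2 * CARD('d)\<^sup>2"
  shows "\<exists>(A :: (('d \<Rightarrow> nat) \<times> ('d \<Rightarrow> nat)) set) s. finite A \<and> (\<forall>p\<in>A. fst p \<le> snd p) \<and>
    card A \<le> l ^ (2 * CARD('d)\<^sup>2 * l) \<and> l ^ (CARD('d) - 1) * s \<le> 12 * card A \<and> s > 0 \<and>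
    (\<forall>x. card {p\<in>A. x \<in> {fst p..snd p}} \<le> 2 * CARD('d) ^ 3 * l) \<and>
    (\<forall>I\<subseteq>A. (\<forall>p\<in>I. \<forall>q\<in>I. p \<noteq> q \<longrightarrow> {fst p..snd p} \<inter> {fst q..snd q} = {}) \<longrightarrow> card I \<le> s)"
proof -
  define d where "d = CARD('d)"
  define k where "k = l ^ (2 * d + 2)"
  define m where "m = (d - 1) * l"
  define R where "R = k ^ m"
  define S where "S = l ^ (d - 1)"
  define Q where "Q = l ^ d"
  define t where "t = 2 * d ^ 3 * l"
  define s where "s = 12 * (R div Q)"
  define v where "v = k ^ ((d - 1) * m)"
  have d2: "d \<ge> 2" using d by (simp add: d_def)
  have l0: "l > 0"
  proof -
    have "CARD('d)\<^sup>2 > 0" by simp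
    then show ?thesis using l by linarith
  qed
  have pos: "k > 0" "Q > 0" "v > 0" "R > 0" using l0 by (simp_all add: k_def Q_def v_def R_def)
  note bounds = parameter_bounds[OF d2 l[folded d_def], folded k_def m_def, folded R_def S_def Q_def,
    folded t_def s_def]
  obtain Sh :: "('d \<Rightarrow> nat) set" where Sh: "finite Sh" "card Sh = S"
    "\<And>b i. b \<in> Sh \<Longrightarrow> b i \<le> m" "\<And>b. b \<in> Sh \<Longrightarrow> sum b UNIV = (d - 1) * m"
    using equal_volume_shapes_exist[OF d m_def[unfolded d_def] l0] unfolding d_def S_def by metis
  \<comment> \<open>A cube of side \<open>k ^ m\<close>; with the common volume
    \<open>v = k ^ ((d - 1) * m)\<close>, exactly \<open>R = k ^ m\<close> boxes of each shape fill
    it.\<close>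
  define \<Omega> :: "('d \<Rightarrow> nat) set" where "\<Omega> = (\<Pi>\<^sub>E i\<in>UNIV. {..<k ^ m})"
  define U where "U = Sigma Sh (\<lambda>b. \<Pi>\<^sub>E i\<in>UNIV. {..<k ^ (m - b i)})"
  have fin: "finite \<Omega>" "finite U"
    using Sh(1) by (auto simp: \<Omega>_def U_def intro!: finite_PiE)
  have cardOm: "card \<Omega> = k ^ (d * m)"
    by (simp add: \<Omega>_def card_PiE d_def mult.commute flip: power_mult)
  have "d * m = m + (d - 1) * m" using d2 by (cases d) auto
  then have vol: "card \<Omega> = R * v" by (simp add: cardOm R_def v_def power_add)
  have cardU: "card U = S * R"
  proof -
    have "(\<Prod>i\<in>UNIV. k ^ (m - b i)) = R" if "b \<in> Sh" for b
    proof -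
      have "(\<Sum>i\<in>UNIV. m - b i) + sum b UNIV = (\<Sum>i\<in>UNIV. m - b i + b i)"
        by (simp add: sum.distrib)
      also have "\<dots> = (\<Sum>i\<in>(UNIV :: 'd set). m)" using Sh(3)[OF that] by (intro sum.cong) auto
      also have "\<dots> = d * m" by (simp add: d_def)
      finally have "(\<Sum>i\<in>UNIV. m - b i) = m" using Sh(4)[OF that] \<open>d * m = _\<close> by simp
      then show ?thesis by (simp add: R_def flip: power_sum)
    qed
    then show ?thesis using Sh by (simp add: U_def card_SigmaI finite_PiE card_PiE)
  qed
  have U: "b \<in> Sh" "j i < k ^ (m - b i)" if "(b, j) \<in> U" for b j i
    using that by (auto simp: U_def PiE_iff)
  have sub: "grid_box k u \<subseteq> \<Omega> \<and> card (grid_box k u) = v" if u: "u \<in> U" for u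
  proof -
    obtain b j where bj: "u = (b, j)" by (cases u)
    note U' = U[OF u[unfolded bj]]
    have "x i < k ^ m" if x: "x \<in> grid_box k (b, j)" for x i
    proof -
      have "x i div k ^ b i < k ^ (m - b i)" using x U'(2) mem_grid_box[OF pos(1)] by metis
      then have "x i < k ^ (m - b i) * k ^ b i" using pos by (simp add: div_less_iff_less_mult)
      also have "\<dots> = k ^ m" using Sh(3)[OF U'(1), of i] by (simp flip: power_add)
      finally show ?thesis .
    qed
    then show ?thesis
      using card_grid_box[OF pos(1), of b j] Sh(4)[OF U'(1)]
      unfolding bj \<Omega>_def v_def by (auto simp only: PiE_iff extensional_UNIV)
  qed
  have small: "k * card (grid_box k u \<inter> grid_box k u') \<le> v" if "u \<in> U" "u' \<in> U" "u \<noteq> u'" for u u'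
  proof -
    obtain b j b' j' where bj: "u = (b, j)" "u' = (b', j')" by (cases u, cases u')
    have "sum b UNIV = (d - 1) * m" "sum b' UNIV = (d - 1) * m"
      using that U(1) Sh(4) unfolding bj by blast+
    then show ?thesis
      using card_grid_box_Int[OF pos(1), of b b' j j'] that(3) unfolding bj v_def by simp
  qed
  have depth: "card {u\<in>U. x \<in> grid_box k u} \<le> S" for x
  proof -
    have "{u\<in>U. x \<in> grid_box k u} \<subseteq> (\<lambda>b. (b, \<lambda>i. x i div k ^ b i)) ` Sh"
    proof
      fix u assume "u \<in> {u\<in>U. x \<in> grid_box k u}"
      then obtain b j where "u = (b, j)" "(b, j) \<in> U" "x \<in> grid_box k (b, j)" by (cases u) auto
      then show "u \<in> (\<lambda>b. (b, \<lambda>i. x i div k ^ b i)) ` Sh"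
        using U(1) mem_grid_box[OF pos(1), of x b j] by (auto simp: image_iff fun_eq_iff)
    qed
    then show ?thesis using Sh surj_card_le by blast
  qed
  have "\<exists>A\<subseteq>U. card U \<le> card A * Q \<and> (\<forall>x\<in>\<Omega>. card {u\<in>A. x \<in> grid_box k u} < t) \<and>
    (\<forall>I\<subseteq>A. (\<forall>u\<in>I. \<forall>u'\<in>I. u \<noteq> u' \<longrightarrow> grid_box k u \<inter> grid_box k u' = {}) \<longrightarrow> card I < s)"
    by (rule sparse_subfamily[where v = v and k = k and R = R and S = S])
       (use fin pos sub small depth vol bounds in \<open>simp_all add: cardU cardOm\<close>)
  then obtain A where A: "A \<subseteq> U" "card U \<le> card A * Q"
    "\<And>x. x \<in> \<Omega> \<Longrightarrow> card {u\<in>A. x \<in> grid_box k u} < t"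
    "\<And>I. I \<subseteq> A \<Longrightarrow> (\<forall>u\<in>I. \<forall>u'\<in>I. u \<noteq> u' \<longrightarrow> grid_box k u \<inter> grid_box k u' = {}) \<Longrightarrow> card I < s"
    by blast
  have finA: "finite A" using A(1) fin(2) by (rule finite_subset)
  have t0: "t > 0" using l0 d2 by (simp add: t_def)
  have depthA: "card {u\<in>A. x \<in> grid_box k u} \<le> t" for x
  proof (cases "x \<in> \<Omega>")
    case False
    then have "{u\<in>A. x \<in> grid_box k u} = {}" using A(1) sub by blast
    then show ?thesis by (simp only: card.empty)
  qed (use A(3) in \<open>simp add: less_imp_le\<close>)
  define h where "h u = (grid_lo k u, grid_hi k u)" for u :: "('d \<Rightarrow> nat) \<times> ('d \<Rightarrow> nat)"
  have "k \<ge> 2"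
  proof -
    have "4 \<le> d\<^sup>2" using d2 power_mono[of 2 d 2] by simp
    then have "l \<ge> 2" using l unfolding d_def by linarith
    then have "l ^ 1 \<le> k" "2 \<le> l" unfolding k_def by (auto intro!: power_increasing)
    then show ?thesis by simp
  qed
  \<comment> \<open>Equal corners for distinct \<open>u\<close> and \<open>u'\<close> would make a
    box of \<open>v\<close> points meet itself in at most \<open>v / k\<close> points.\<close>
  have inj: "inj_on h A"
  proof (rule inj_onI, rule ccontr)
    fix u u' assume u: "u \<in> A" "u' \<in> A" "h u = h u'" "u \<noteq> u'"
    then have "grid_box k u = grid_box k u'" by (simp add: h_def)
    moreover have "u \<in> U" "u' \<in> U" using u A(1) by auto
    ultimately have "k * v \<le> v" using small[of u u'] sub[of u'] u(4) by (metis Int_absorb)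
    then show False using \<open>k \<ge> 2\<close> pos by simp
  qed
  have "fst (h u) \<le> snd (h u)" if "u \<in> A" for u
  proof -
    have "card (grid_box k u) \<noteq> 0" using sub[of u] A(1) that pos by (metis subsetD less_irrefl)
    then have "grid_box k u \<noteq> {}" by (metis card.empty)
    then show ?thesis by (simp add: h_def)
  qed
  moreover have "card {p\<in>h ` A. x \<in> {fst p..snd p}} \<le> t" for x
  proof -
    have "{p\<in>h ` A. x \<in> {fst p..snd p}} = h ` {u\<in>A. x \<in> grid_box k u}"
      by (auto simp: h_def)
    then show ?thesis
      using card_image_le[of "{u\<in>A. x \<in> grid_box k u}" h] finA depthA[of x] by simp
  qed
  moreover have "card I \<le> s"
    if I: "I \<subseteq> h ` A" "\<forall>p\<in>I. \<forall>q\<in>I. p \<noteq> q \<longrightarrow> {fst p..snd p} \<inter> {fst q..snd q} = {}" for I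
  proof -
    obtain J where J: "J \<subseteq> A" "I = h ` J" using I(1) by (meson subset_imageE)
    have "grid_box k u \<inter> grid_box k u' = {}" if "u \<in> J" "u' \<in> J" "u \<noteq> u'" for u u'
    proof -
      have "h u \<noteq> h u'" using that J inj by (meson inj_on_contraD subsetD)
      then show ?thesis using I(2) that J(2) unfolding h_def by fastforce
    qed
    then have "card J < s" using A(4)[OF J(1)] by blast
    moreover have "card I \<le> card J" unfolding J(2) using J(1) finA by (intro card_image_le) (auto intro: finite_subset)
    ultimately show ?thesis by simp
  qed
  moreover have cardA: "card (h ` A) = card A" using inj by (rule card_image)
  moreover have "card A \<le> l ^ (2 * d\<^sup>2 * l)"
    using card_mono[OF fin(2) A(1)] bounds(4) by (simp add: cardU)
  moreover have "S * s \<le> 12 * card A"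
  proof -
    \<comment> \<open>Independent sets have size at most \<open>s = 12 * R / Q\<close>, while
      \<open>A\<close> keeps at least \<open>S * R / Q\<close> boxes.\<close>
    have "Q * (S * s) = 12 * (S * R)" using bounds(5) by (metis mult.assoc mult.commute)
    also have "\<dots> \<le> 12 * (card A * Q)" using A(2) cardU by simp
    finally have "Q * (S * s) \<le> Q * (12 * card A)" by (simp add: mult_ac)
    then show ?thesis using pos by simp
  qed
  moreover have "s > 0" using A(4)[of "{}"] by simp
  ultimately show ?thesis
    using finA unfolding d_def S_def t_def by (intro exI[of _ "h ` A"] exI[of _ s]) simp
qed

section \<open>Blowing up integer boxes\<close>

lemma clique_number_le:
  assumes "finite V" and "\<And>K. K \<subseteq> V \<Longrightarrow> clique K E \<Longrightarrow> card K \<le> b"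
  shows "clique_number V E \<le> b"
proof -
  have "{card K | K. K \<subseteq> V \<and> clique K E} \<subseteq> {..b}" using assms(2) by auto
  moreover have "0 \<in> {card K | K. K \<subseteq> V \<and> clique K E}" by (auto intro!: exI[of _ "{}"])
  ultimately show ?thesis
    unfolding clique_number_def by (subst Max_le_iff) (auto intro: finite_subset)
qed

text \<open>An injective numbering of \<open>V\<close> is a proper colouring, so the
  \<open>LEAST\<close> is attained. A singleton edge \<open>{v} = {v, v}\<close> at a vertex would
  demand \<open>f v \<noteq> f v\<close>.\<close>

lemma proper_coloring_chromatic_number:
  assumes "finite V" and "\<And>v. {v} \<notin> E"
  shows "\<exists>f. proper_coloring V E (chromatic_number V E) f"
  unfolding chromatic_number_def
proof (rule LeastI_ex)
  obtain f where "bij_betw f V {0..<card V}" using ex_bij_betw_finite_nat[OF assms(1)] by blast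
  then have "proper_coloring V E (card V) f"
    using assms(2) by (fastforce simp: proper_coloring_def bij_betw_def inj_on_def)
  then show "\<exists>k f. proper_coloring V E k f" by blast
qed

lemma chromatic_number_pos:
  assumes "finite V" "V \<noteq> {}" and "\<And>v. {v} \<notin> E"
  shows "chromatic_number V E \<ge> 1"
proof -
  obtain f where "proper_coloring V E (chromatic_number V E) f"
    using proper_coloring_chromatic_number[OF assms(1,3)] by blast
  then show ?thesis using assms(2) by (cases "chromatic_number V E") (auto simp: proper_coloring_def)
qed

lemma intersection_edges_iff:
  "{X, Y} \<in> intersection_edges F \<longleftrightarrow> X \<in> F \<and> Y \<in> F \<and> X \<noteq> Y \<and> X \<inter> Y \<noteq> {}"
  by (auto simp: intersection_edges_def doubleton_eq_iff)

lemma singleton_notin_intersection_edges: "{X} \<notin> intersection_edges F"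
  using intersection_edges_iff[of X X F] by simp

text \<open>A clique of copies projects to pairwise meeting boxes, which share an integer point by
  Helly, so it uses at most \<open>t\<close> boxes with \<open>r\<close> copies each. Copies of one
  box always meet, so a colour class uses each box at most once and projects to an independent set
  of at most \<open>s\<close> boxes. Isolated padding points raise the size of the family to
  \<open>n\<close>.\<close>

lemma blow_up_boxes:
  fixes A :: "(('d::finite \<Rightarrow> nat) \<times> ('d \<Rightarrow> nat)) set"
  assumes finA: "finite A" and le: "\<And>p. p \<in> A \<Longrightarrow> fst p \<le> snd p"
    and depth: "\<And>x. card {p\<in>A. x \<in> {fst p..snd p}} \<le> t"
    and indep: "\<And>I. I \<subseteq> A \<Longrightarrow>
      (\<forall>p\<in>I. \<forall>q\<in>I. p \<noteq> q \<longrightarrow> {fst p..snd p} \<inter> {fst q..snd q} = {}) \<Longrightarrow> card I \<le> s"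
    and pos: "t \<ge> 1" "r \<ge> 1" and n: "card A * r \<le> n"
  shows "\<exists>F :: (real ^ 'd) set set. finite F \<and> card F = n \<and> (\<forall>X\<in>F. axis_parallel_box X) \<and>
    clique_number F (intersection_edges F) \<le> t * r \<and>
    card A * r \<le> chromatic_number F (intersection_edges F) * s"
proof -
  \<comment> \<open>All corners are integral, so enlarging a box by less than 1 creates no new intersections.\<close>
  define Z :: "(('d \<Rightarrow> nat) \<times> ('d \<Rightarrow> nat)) \<times> nat \<Rightarrow> (real ^ 'd) set" where
    "Z w = cbox (\<chi> i. real (fst (fst w) i)) (\<chi> i. real (snd (fst w) i) + real (snd w) / real r)" for w
  \<comment> \<open>Single points with negative coordinates, hence outside every \<open>Z w\<close>,
    whose lower corner is nonnegative.\<close>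
  define pad :: "nat \<Rightarrow> (real ^ 'd) set" where
    "pad j = cbox (\<chi> i. - real (Suc j)) (\<chi> i. - real (Suc j))" for j
  define D where "D = A \<times> {..<r}"
  define F1 where "F1 = Z ` D"
  define F2 where "F2 = pad ` {..<n - card A * r}"
  define F where "F = F1 \<union> F2"
  have memZ: "x \<in> Z (p, j) \<longleftrightarrow> (\<forall>i. real (fst p i) \<le> x $ i \<and> x $ i \<le> real (snd p i) + real j / real r)" for x p j
    by (simp add: Z_def mem_box_cart)
  have memP: "x \<in> pad j \<longleftrightarrow> x = (\<chi> i. - real (Suc j))" for x j
    by (simp add: pad_def)
  have frac: "0 \<le> real j / real r" "real j / real r < 1" if "j < r" for j
    using that by auto
  have ZI: "Z (p, j) \<inter> Z (q, j') \<noteq> {}"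
    if "p \<in> A" "q \<in> A" "j < r" "j' < r" "{fst p..snd p} \<inter> {fst q..snd q} \<noteq> {}" for p q j j'
  proof -
    from that(5) obtain x where x: "x \<in> {fst p..snd p}" "x \<in> {fst q..snd q}" by blast
    then have "fst p i \<le> x i" "x i \<le> snd p i" "fst q i \<le> x i" "x i \<le> snd q i" for i
      by (auto simp: le_fun_def)
    then have "(\<chi> i. real (x i)) \<in> Z (p, j) \<inter> Z (q, j')"
      using frac(1)[OF that(3)] frac(1)[OF that(4)] by (auto simp: memZ intro!: add_increasing2)
    then show ?thesis by blast
  qed
  \<comment> \<open>The enlargement is below 1 and the corners are integers, so it cannot create
    this inequality. The Helly argument below uses only this one-sided comparison.\<close>
  have ZD: "fst p \<le> snd q"
    if "j < r" "j' < r" "Z (p, j) \<inter> Z (q, j') \<noteq> {}" for p q j j'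
  proof -
    from that(3) obtain x where x: "x \<in> Z (p, j)" "x \<in> Z (q, j')" by blast
    have "fst p i \<le> snd q i" for i
    proof -
      have "real (fst p i) \<le> real (snd q i) + real j' / real r" using x unfolding memZ by (meson order_trans)
      then have "real (fst p i) < real (snd q i) + 1" using frac(2)[OF that(2)] by simp
      then show ?thesis by linarith
    qed
    then show ?thesis by (simp add: le_fun_def)
  qed
  have ZZ: "Z (p, j) \<noteq> {}" if "p \<in> A" "j < r" for p j
    using ZI[of p p j j] le[of p] that by auto
  have injZ: "inj_on Z D"
  proof (rule inj_onI)
    fix w w' assume w: "w \<in> D" "w' \<in> D" "Z w = Z w'"
    obtain p j q j' where wp: "w = (p, j)" "w' = (q, j')" by (cases w, cases w')
    have pj: "p \<in> A" "q \<in> A" "j < r" "j' < r" using w by (auto simp: wp D_def)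
    have "(\<chi> i. real (fst p i)) = (\<chi> i. real (fst q i)) \<and>
        (\<chi> i. real (snd p i) + real j / real r) = (\<chi> i. real (snd q i) + real j' / real r)"
      using w(3) ZZ[of p j] ZZ[of q j'] pj by (auto simp: wp Z_def eq_cbox)
    then have eq: "fst p i = fst q i" "real (snd p i) + real j / real r = real (snd q i) + real j' / real r" for i
      by (auto simp: vec_eq_iff)
    \<comment> \<open>The added fractions lie in \<open>[0, 1)\<close>, so the integer parts agree;
      any one direction, here \<open>undefined\<close>, then yields \<open>j = j'\<close>.\<close>
    have "snd p i = snd q i" for i
    proof -
      have "real (snd p i) < real (snd q i) + 1" "real (snd q i) < real (snd p i) + 1"
        using eq(2)[of i] frac[OF pj(3)] frac[OF pj(4)] by linarith+
      then show ?thesis by linarith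
    qed
    moreover from this have "j = j'" using eq(2)[of undefined] pos by simp
    ultimately show "w = w'" using eq(1) by (auto simp: wp prod_eq_iff)
  qed
  have injP: "inj_on pad X" for X
    by (rule inj_onI) (metis memP of_nat_eq_iff Suc_inject neg_equal_iff_equal vec_lambda_beta)
  have PZ: "pad i \<inter> Z w = {}" for i w
  proof (cases w)
    case (Pair p j)
    have "(\<chi> i'. - real (Suc i)) \<notin> Z (p, j)"
      unfolding memZ using of_nat_0_le_iff[of "fst p undefined"]
      by (auto simp: not_le intro!: exI[of _ undefined])
    then have "x \<notin> Z (p, j)" if "x \<in> pad i" for x using that[unfolded memP] by simp
    then show ?thesis unfolding Pair by blast
  qed
  have PP: "pad i \<inter> pad j = {}" if "pad i \<noteq> pad j" for i j
  proof (rule ccontr)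
    assume "pad i \<inter> pad j \<noteq> {}"
    then have "(\<chi> i'. - real (Suc i)) = ((\<chi> i'. - real (Suc j)) :: real ^ 'd)"
      using memP[of _ i] memP[of _ j] by auto
    then show False using that by (simp add: pad_def)
  qed
  have nonemptyP: "pad i \<noteq> {}" for i using memP by blast
  have fin: "finite D" "finite F1" "finite F2" "finite F"
    using finA by (auto simp: D_def F1_def F2_def F_def)
  have "F1 \<inter> F2 = {}"
  proof -
    have "Z w \<noteq> pad i" for i w using PZ[of i w] nonemptyP[of i] by auto
    then show ?thesis unfolding F1_def F2_def by blast
  qed
  then have "card F = card F1 + card F2" unfolding F_def using fin by (intro card_Un_disjoint) auto
  also have "card F1 = card A * r" unfolding F1_def using card_image[OF injZ] by (simp add: D_def card_cartesian_product)
  also have "card F2 = n - card A * r" unfolding F2_def using card_image[OF injP] by simp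
  finally have cardF: "card F = n" using n by simp
  have box: "axis_parallel_box X" if "X \<in> F" for X
  proof -
    have "axis_parallel_box (pad i)" for i unfolding pad_def axis_parallel_box_def by blast
    moreover have "axis_parallel_box (Z w)" if "w \<in> D" for w
    proof -
      have "real (fst (fst w) i) \<le> real (snd (fst w) i) + real (snd w) / real r" for i
        using le[of "fst w"] that by (auto simp: D_def le_fun_def intro!: add_increasing2)
      then show ?thesis
        unfolding Z_def axis_parallel_box_def
        by (intro exI[of _ "\<chi> i. real (fst (fst w) i)"]
              exI[of _ "\<chi> i. real (snd (fst w) i) + real (snd w) / real r"]) simp
    qed
    ultimately show ?thesis using that unfolding F_def F1_def F2_def by blast
  qed
  have "clique_number F (intersection_edges F) \<le> t * r"
  proof (rule clique_number_le[OF fin(4)])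
    fix K assume K: "K \<subseteq> F" "clique K (intersection_edges F)"
    then have meet: "X \<inter> Y \<noteq> {}" if "X \<in> K" "Y \<in> K" "X \<noteq> Y" for X Y
      using K(2) that intersection_edges_iff[of X Y F] unfolding clique_def by metis
    show "card K \<le> t * r"
    proof (cases "\<exists>i. pad i \<in> K")
      case True
      then obtain i where i: "pad i \<in> K" by blast
      \<comment> \<open>A padding point meets no other member, so it is the whole clique.\<close>
      have "X = pad i" if X: "X \<in> K" for X
      proof (rule ccontr)
        assume ne: "X \<noteq> pad i"
        have "X \<in> F1 \<or> X \<in> F2" using X K(1) by (auto simp: F_def)
        then have "pad i \<inter> X = {}"
        proof
          assume "X \<in> F1"
          then obtain w where "X = Z w" unfolding F1_def by blast
          then show ?thesis using PZ by simp
        next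
          assume "X \<in> F2"
          then obtain j where "X = pad j" unfolding F2_def by blast
          then show ?thesis using PP[of i j] ne by simp
        qed
        then show False using meet[OF i X] ne by simp
      qed
      then have "K = {pad i}" using i by blast
      then show ?thesis using pos by simp
    next
      case False
      then have K1: "K \<subseteq> F1" using K(1) by (auto simp: F_def F2_def)
      define P where "P = {p\<in>A. \<exists>j<r. Z (p, j) \<in> K}"
      have le': "fst p \<le> snd q" if "p \<in> P" "q \<in> P" for p q
      proof -
        from that obtain j j' where j: "j < r" "j' < r" "Z (p, j) \<in> K" "Z (q, j') \<in> K"
          by (auto simp: P_def)
        show ?thesis
        proof (cases "Z (p, j) = Z (q, j')")
          case True
          then have "p = q" using injZ j that by (auto simp: P_def D_def inj_on_def)
          then show ?thesis using le that by (simp add: P_def)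
        qed (use meet[OF j(3,4)] ZD[OF j(1,2)] in blast)
      qed
      have finP: "finite P" using finA by (simp add: P_def)
      \<comment> \<open>The Helly point: the largest lower corner in each direction, which no upper
        corner lies below. The maximum is evaluated only once a member of \<open>P\<close> is given,
        so over a nonempty set.\<close>
      define x where "x i = Max ((\<lambda>p. fst p i) ` P)" for i
      have "P \<subseteq> {p\<in>A. x \<in> {fst p..snd p}}"
      proof
        fix p assume p: "p \<in> P"
        have "fst p i \<le> x i" for i unfolding x_def using p finP by (intro Max_ge) auto
        moreover have "x i \<le> snd p i" for i
        proof -
          have "fst q i \<le> snd p i" if "q \<in> P" for q using le'[OF that p] by (rule le_funD)
          then show ?thesis unfolding x_def using p finP by (intro Max.boundedI) blast+
        qed
        ultimately show "p \<in> {p\<in>A. x \<in> {fst p..snd p}}" using p by (auto simp: P_def le_fun_def)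
      qed
      then have "card P \<le> card {p\<in>A. x \<in> {fst p..snd p}}" using finA by (intro card_mono) auto
      also have "\<dots> \<le> t" by (rule depth)
      finally have cP: "card P \<le> t" .
      have "K \<subseteq> Z ` (P \<times> {..<r})" using K1 by (auto simp: F1_def D_def P_def)
      then have "card K \<le> card (Z ` (P \<times> {..<r}))" using finP by (intro card_mono) auto
      also have "\<dots> \<le> card (P \<times> {..<r})" using finP by (intro card_image_le) auto
      also have "\<dots> \<le> t * r" using cP by (simp add: card_cartesian_product)
      finally show ?thesis .
    qed
  qed
  moreover have "card A * r \<le> chromatic_number F (intersection_edges F) * s"
  proof -
    define c where "c = chromatic_number F (intersection_edges F)"
    obtain f where f: "proper_coloring F (intersection_edges F) c f"
      using proper_coloring_chromatic_number[OF fin(4) singleton_notin_intersection_edges]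
      unfolding c_def by blast
    have ZF: "Z w \<in> F" if "w \<in> D" for w using that by (auto simp: F_def F1_def)
    have disj: "fst w \<noteq> fst w' \<and> {fst (fst w)..snd (fst w)} \<inter> {fst (fst w')..snd (fst w')} = {}"
      if w: "w \<in> D" "w' \<in> D" "w \<noteq> w'" "f (Z w) = f (Z w')" for w w'
    proof -
      have "Z w \<noteq> Z w'" using injZ w by (auto simp: inj_on_def)
      then have *: "Z w \<inter> Z w' = {}"
        using f w ZF[OF w(1)] ZF[OF w(2)] unfolding proper_coloring_def intersection_edges_iff by blast
      obtain p j q j' where wp: "w = (p, j)" "w' = (q, j')" by (cases w, cases w')
      have "{fst p..snd p} \<inter> {fst q..snd q} = {}"
        using ZI[of p q j j'] * w(1,2) by (auto simp: wp D_def)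
      moreover have "{fst p..snd p} \<noteq> {}" using le[of p] w(1) by (simp add: wp D_def)
      ultimately show ?thesis by (auto simp: wp)
    qed
    define M where "M a = {w\<in>D. f (Z w) = a}" for a
    have "card (M a) \<le> s" for a
    proof -
      have "inj_on fst (M a)"
      proof (rule inj_onI, rule ccontr)
        fix w w' assume "w \<in> M a" "w' \<in> M a" "fst w = fst w'" "w \<noteq> w'"
        then show False using disj[of w w'] by (simp add: M_def)
      qed
      then have "card (M a) = card (fst ` M a)" by (simp add: card_image)
      also have "\<dots> \<le> s"
      proof (rule indep)
        show "fst ` M a \<subseteq> A" by (auto simp: M_def D_def)
        show "\<forall>p\<in>fst ` M a. \<forall>q\<in>fst ` M a. p \<noteq> q \<longrightarrow> {fst p..snd p} \<inter> {fst q..snd q} = {}"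
        proof (intro ballI impI)
          fix p q assume "p \<in> fst ` M a" "q \<in> fst ` M a" "p \<noteq> q"
          then obtain w w' where "w \<in> M a" "w' \<in> M a" "p = fst w" "q = fst w'" "w \<noteq> w'" by blast
          then show "{fst p..snd p} \<inter> {fst q..snd q} = {}" using disj[of w w'] by (simp add: M_def)
        qed
      qed
      finally show ?thesis .
    qed
    moreover have "f (Z w) < c" if "w \<in> D" for w
      using f ZF[OF that] by (auto simp: proper_coloring_def Pi_iff)
    then have "D = (\<Union>a<c. M a)" unfolding M_def by blast
    then have "card D \<le> (\<Sum>a<c. card (M a))" by (metis card_UN_le finite_lessThan)
    ultimately have "card D \<le> (\<Sum>a<c. s)" by (meson order_trans sum_mono)
    then show ?thesis by (simp add: D_def c_def card_cartesian_product)
  qed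
  ultimately show ?thesis using fin(4) cardF box by (intro exI[of _ F]) blast
qed

section \<open>Choice of parameters\<close>

text \<open>The factor \<open>s\<close> cancels between the bound on colour classes and the bound
  \<open>12 / S\<close> on the fraction of an independent set. The parameters \<open>l\<close> and
  \<open>r\<close> stay free, to be fitted to \<open>n\<close> and \<open>\<omega>\<close>.\<close>

lemma boxes_with_large_chromatic_number:
  fixes l r n :: nat
  assumes d: "CARD('d::finite) \<ge> 2" and l: "l \<ge> 2 * CARD('d)\<^sup>2" and r: "r \<ge> 1"
    and n: "l ^ (2 * CARD('d)\<^sup>2 * l) * r \<le> n"
  shows "\<exists>F :: (real ^ 'd) set set. finite F \<and> card F = n \<and> (\<forall>X\<in>F. axis_parallel_box X) \<and>
    clique_number F (intersection_edges F) \<le> 2 * CARD('d) ^ 3 * l * r \<and>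
    l ^ (CARD('d) - 1) * r \<le> 12 * chromatic_number F (intersection_edges F)"
proof -
  obtain A :: "(('d \<Rightarrow> nat) \<times> ('d \<Rightarrow> nat)) set" and s where A: "finite A" "\<forall>p\<in>A. fst p \<le> snd p"
    "card A \<le> l ^ (2 * CARD('d)\<^sup>2 * l)" "l ^ (CARD('d) - 1) * s \<le> 12 * card A" "s > 0"
    "\<forall>x. card {p\<in>A. x \<in> {fst p..snd p}} \<le> 2 * CARD('d) ^ 3 * l"
    "\<forall>I\<subseteq>A. (\<forall>p\<in>I. \<forall>q\<in>I. p \<noteq> q \<longrightarrow> {fst p..snd p} \<inter> {fst q..snd q} = {}) \<longrightarrow> card I \<le> s"
    using sparse_integer_boxes[OF d l] by (elim exE conjE)
  have "CARD('d)\<^sup>2 > 0" by simp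
  then have "l \<ge> 1" using l by linarith
  then have t: "1 \<le> 2 * CARD('d) ^ 3 * l" by (simp add: Suc_le_eq)
  have "card A * r \<le> n" using A(3) n by (meson mult_le_mono1 order_trans)
  then have "\<exists>F :: (real ^ 'd) set set. finite F \<and> card F = n \<and> (\<forall>X\<in>F. axis_parallel_box X) \<and>
      clique_number F (intersection_edges F) \<le> 2 * CARD('d) ^ 3 * l * r \<and>
      card A * r \<le> chromatic_number F (intersection_edges F) * s"
    using A t r by (intro blow_up_boxes) auto
  then obtain F :: "(real ^ 'd) set set" where F: "finite F" "card F = n" "\<forall>X\<in>F. axis_parallel_box X"
    "clique_number F (intersection_edges F) \<le> 2 * CARD('d) ^ 3 * l * r"
    "card A * r \<le> chromatic_number F (intersection_edges F) * s"
    by (elim exE conjE)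
  have "l ^ (CARD('d) - 1) * r * s = l ^ (CARD('d) - 1) * s * r" by simp
  also have "\<dots> \<le> 12 * card A * r" using A(4) by (rule mult_right_mono) simp
  also have "\<dots> \<le> 12 * chromatic_number F (intersection_edges F) * s" using F(5) by simp
  finally have "l ^ (CARD('d) - 1) * r \<le> 12 * chromatic_number F (intersection_edges F)"
    using A(5) by simp
  then show ?thesis using F by blast
qed

text \<open>The hypothesis \<open>\<omega> \<ge> 1\<close> matters for \<open>n\<close> equal to 1
  or 2: there the quotient of logarithms is not positive and would admit
  \<open>\<omega> < 1\<close>, while a nonempty family has clique number at least 1.\<close>

theorem theorem3:
  fixes \<epsilon> :: real
  assumes "CARD('d::finite) \<ge> 3" and "\<epsilon> > 0"
  shows "\<exists>c c' :: real. c > 0 \<and> c' > 0 \<and>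
    (\<forall>(n::nat) (\<omega>::real).
       n \<ge> 1 \<longrightarrow> \<omega> \<ge> 1 \<longrightarrow>
       c * (ln (real n) / ln (ln (real n))) \<le> \<omega> \<longrightarrow> \<omega> \<le> real n powr (1 - \<epsilon>) \<longrightarrow>
       (\<exists>F :: (real ^ 'd) set set.
          finite F \<and> card F = n \<and> (\<forall>X\<in>F. axis_parallel_box X) \<and>
          real (clique_number F (intersection_edges F)) \<le> \<omega> \<and>
          real (chromatic_number F (intersection_edges F))
            \<ge> c' * \<omega> * (ln (real n) / ln (ln (real n))) ^ (CARD('d) - 2)))"
proof -
  define d where "d = CARD('d)"
  define L where "L n = ln (real n) / ln (ln (real n))" for n
  \<comment> \<open>Chosen so that \<open>l \<le> \<eta> * L n\<close> implies
    \<open>l ^ (2 * d\<^sup>2 * l) \<le> n powr \<epsilon>\<close> for large \<open>n\<close>; the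
    minimum with 1 gives \<open>l \<le> L n\<close>.\<close>
  define \<eta> where "\<eta> = min 1 (\<epsilon> / (2 * real d ^ 2))"
  have d3: "d \<ge> 3" using assms(1) by (simp add: d_def)
  have eta: "0 < \<eta>" "\<eta> \<le> 1" "2 * real d ^ 2 * \<eta> \<le> \<epsilon>"
    using assms(2) d3 by (auto simp: \<eta>_def min_def field_simps)
  \<comment> \<open>From some \<open>n0\<close> on,
    \<open>\<eta> * L n \<ge> 2 * d\<^sup>2 + 1\<close>, so its integer part is an admissible
    \<open>l\<close>, and \<open>ln (ln n) \<ge> 1\<close> gives
    \<open>L n \<le> ln n\<close>.\<close>
  have "filterlim L at_top at_top" unfolding L_def by real_asymp
  then have "\<forall>\<^sub>F n in at_top. (2 * real d ^ 2 + 1) / \<eta> \<le> L n"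
    by (simp add: filterlim_at_top)
  moreover have "\<forall>\<^sub>F n::nat in at_top. ln (ln (real n)) \<ge> 1" by real_asymp
  ultimately have "\<forall>\<^sub>F n::nat in at_top. (2 * real d ^ 2 + 1) / \<eta> \<le> L n \<and> ln (ln (real n)) \<ge> 1"
    by (rule eventually_conj)
  then obtain n0 where n0: "\<And>n. n \<ge> n0 \<Longrightarrow> (2 * real d ^ 2 + 1) / \<eta> \<le> L n"
    "\<And>n. n \<ge> n0 \<Longrightarrow> ln (ln (real n)) \<ge> 1"
    unfolding eventually_at_top_linorder by blast
  \<comment> \<open>Covers the finitely many \<open>n < n0\<close>, where
    \<open>\<omega> \<le> n\<close>. Absolute values are taken because \<open>L n\<close> can be
    negative; the \<open>+ 1\<close> keeps \<open>M\<close> positive.\<close>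
  define M where "M = (\<Sum>n<n0. \<bar>real n * L n ^ (d - 2)\<bar>) + 1"
  have M: "M \<ge> 1" unfolding M_def by (simp add: sum_nonneg)
  \<comment> \<open>Makes \<open>t = 2 * d ^ 3 * l\<close> at most \<open>c * L n\<close>, hence at
    most \<open>\<omega>\<close>, so that there is room for at least one copy.\<close>
  define c where "c = 2 * real d ^ 3"
  \<comment> \<open>The first entry serves \<open>n < n0\<close>. In the second,
    \<open>\<eta> / 2\<close> comes from \<open>l \<ge> \<eta> / 2 * L n\<close>, and 48 is 12 from
    the independence bound, 2 from \<open>t\<close> and 2 from rounding \<open>r\<close>.\<close>
  define c' where "c' = min (1 / M) ((\<eta> / 2) ^ (d - 2) / (48 * real d ^ 3))"
  have c: "c > 0" "c' > 0" using d3 M eta by (auto simp: c_def c'_def)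
  have "\<exists>F :: (real ^ 'd) set set.
      finite F \<and> card F = n \<and> (\<forall>X\<in>F. axis_parallel_box X) \<and>
      real (clique_number F (intersection_edges F)) \<le> \<omega> \<and>
      real (chromatic_number F (intersection_edges F)) \<ge> c' * \<omega> * L n ^ (d - 2)"
    if n: "n \<ge> 1" and om: "\<omega> \<ge> 1" "c * L n \<le> \<omega>" "\<omega> \<le> real n powr (1 - \<epsilon>)" for n \<omega>
  proof (cases "n < n0")
    case True
    \<comment> \<open>With \<open>A\<close> empty the family consists of \<open>n\<close> padding
      points.\<close>
    have "\<exists>F :: (real ^ 'd) set set. finite F \<and> card F = n \<and> (\<forall>X\<in>F. axis_parallel_box X) \<and>
      clique_number F (intersection_edges F) \<le> 1 * 1 \<and>
      card ({} :: (('d \<Rightarrow> nat) \<times> ('d \<Rightarrow> nat)) set) * 1 \<le> chromatic_number F (intersection_edges F) * 0"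
      by (rule blow_up_boxes) auto
    then obtain F :: "(real ^ 'd) set set" where F: "finite F" "card F = n" "\<forall>X\<in>F. axis_parallel_box X"
      "clique_number F (intersection_edges F) \<le> 1" by auto
    have chi: "chromatic_number F (intersection_edges F) \<ge> 1"
      using F n singleton_notin_intersection_edges by (intro chromatic_number_pos) auto
    have "real n powr (1 - \<epsilon>) \<le> real n powr 1" using n assms(2) by (intro powr_mono) auto
    then have "\<omega> \<le> real n" using om n by simp
    then have "\<omega> * \<bar>L n ^ (d - 2)\<bar> \<le> real n * \<bar>L n ^ (d - 2)\<bar>" by (intro mult_right_mono) auto
    also have "\<dots> = \<bar>real n * L n ^ (d - 2)\<bar>" by (simp add: abs_mult)
    also have "\<dots> \<le> (\<Sum>n<n0. \<bar>real n * L n ^ (d - 2)\<bar>)" using True by (intro member_le_sum) auto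
    finally have leM: "\<omega> * \<bar>L n ^ (d - 2)\<bar> \<le> M" by (simp add: M_def)
    have "c' * \<omega> * L n ^ (d - 2) \<le> c' * (\<omega> * \<bar>L n ^ (d - 2)\<bar>)"
      using c om by (simp add: mult_left_mono mult.assoc)
    also have "\<dots> \<le> 1 / M * M"
      using c om M leM by (intro mult_mono) (auto simp: c'_def)
    also have "\<dots> = 1" using M by simp
    finally have "c' * \<omega> * L n ^ (d - 2) \<le> real (chromatic_number F (intersection_edges F))"
      using chi by linarith
    moreover have "real (clique_number F (intersection_edges F)) \<le> \<omega>" using F(4) om(1) by linarith
    ultimately show ?thesis using F by blast
  next
    case False
    then have big: "(2 * real d ^ 2 + 1) / \<eta> \<le> L n" "ln (ln (real n)) \<ge> 1" using n0[of n] by auto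
    have etaL: "2 * real d ^ 2 + 1 \<le> \<eta> * L n" using big(1) eta by (simp add: field_simps)
    have Lpos: "L n > 0" using big(1) eta by (smt (verit) divide_pos_pos zero_le_power2)
    have lnpos: "ln (real n) > 0" using Lpos big(2) by (simp add: L_def zero_less_divide_iff)
    have ln1: "1 < ln (real n)" using big(2) lnpos ln_gt_zero_iff[OF lnpos] by linarith
    define l where "l = nat \<lfloor>\<eta> * L n\<rfloor>"
    have "real l = of_int \<lfloor>\<eta> * L n\<rfloor>" using eta Lpos by (simp add: l_def)
    then have "real l \<le> \<eta> * L n" "\<eta> * L n - 1 \<le> real l" by linarith+
    have lL: "real l \<le> L n" using \<open>real l \<le> \<eta> * L n\<close> mult_right_mono[OF eta(2), of "L n"] Lpos by linarith
    have "real (2 * d\<^sup>2) \<le> real l" using etaL \<open>\<eta> * L n - 1 \<le> real l\<close> by simp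
    then have ld: "2 * d\<^sup>2 \<le> l" by (simp only: of_nat_le_iff)
    \<comment> \<open>Rounding down loses at most 1, which is at most half of
      \<open>\<eta> * L n\<close>.\<close>
    have lhalf: "\<eta> / 2 * L n \<le> real l"
    proof -
      have "real d ^ 2 \<ge> 1" using d3 by (intro one_le_power) simp
      then show ?thesis using etaL \<open>\<eta> * L n - 1 \<le> real l\<close> by simp
    qed
    have lpos: "l > 0" using ld d3 by (auto intro!: Nat.gr0I)
    define t where "t = 2 * d ^ 3 * l"
    have tpos: "real t > 0" using lpos d3 by (simp add: t_def)
    have "real t = c * real l" by (simp add: t_def c_def)
    also have "\<dots> \<le> c * L n" using c lL by simp
    finally have tom: "real t \<le> \<omega>" using om by simp
    define r where "r = nat \<lfloor>\<omega> / real t\<rfloor>"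
    have one: "1 \<le> \<omega> / real t" using tom tpos by simp
    have "real r = of_int \<lfloor>\<omega> / real t\<rfloor>" using one by (simp add: r_def)
    then have r: "real r \<le> \<omega> / real t" "\<omega> / real t - 1 \<le> real r" "r \<ge> 1"
      using one by linarith+
    have rhalf: "\<omega> / real t \<le> 2 * real r" using r by linarith
    \<comment> \<open>In logarithms: \<open>l \<le> ln n\<close> gives
      \<open>l * ln l \<le> \<eta> * L n * ln (ln n) = \<eta> * ln n\<close>. The remaining factor
      \<open>n powr (1 - \<epsilon>)\<close> bounds the number \<open>r \<le> \<omega>\<close> of
      copies.\<close>
    have size: "real (l ^ (2 * d\<^sup>2 * l)) \<le> real n powr \<epsilon>"
    proof -
      have "L n \<le> ln (real n)" using divide_left_mono[OF big(2), of "ln (real n)"] ln1 by (simp add: L_def)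
      then have "ln (real l) \<le> ln (ln (real n))" using lL lpos lnpos by simp
      then have "real l * ln (real l) \<le> \<eta> * L n * ln (ln (real n))"
        using \<open>real l \<le> \<eta> * L n\<close> lpos by (intro mult_mono) auto
      also have "\<dots> = \<eta> * ln (real n)" using ln1 by (simp add: L_def)
      finally have "2 * real d ^ 2 * (real l * ln (real l)) \<le> 2 * real d ^ 2 * (\<eta> * ln (real n))"
        by (intro mult_left_mono) auto
      also have "\<dots> \<le> \<epsilon> * ln (real n)" using eta(3) lnpos by (simp add: mult_right_mono flip: mult.assoc)
      finally have "real (2 * d\<^sup>2 * l) * ln (real l) \<le> \<epsilon> * ln (real n)" by (simp add: mult.assoc)
      then have "exp (real (2 * d\<^sup>2 * l) * ln (real l)) \<le> exp (\<epsilon> * ln (real n))" by simp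
      then show ?thesis using lpos n by (simp only: exp_of_nat_mult) (simp add: powr_def)
    qed
    have "l ^ (2 * d\<^sup>2 * l) * r \<le> n"
    proof -
      have "1 \<le> real t" using tpos by simp
      then have "\<omega> / real t \<le> \<omega>" using om by (simp add: field_simps)
      then have "real r \<le> real n powr (1 - \<epsilon>)" using r(1) om by linarith
      then have "real (l ^ (2 * d\<^sup>2 * l)) * real r \<le> real n powr \<epsilon> * real n powr (1 - \<epsilon>)"
        using size by (intro mult_mono) auto
      also have "\<dots> = real n" using n by (simp flip: powr_add)
      finally have "real (l ^ (2 * d\<^sup>2 * l) * r) \<le> real n" by simp
      then show ?thesis by (simp only: of_nat_le_iff)
    qed
    then obtain F :: "(real ^ 'd) set set" where F: "finite F" "card F = n" "\<forall>X\<in>F. axis_parallel_box X"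
      "clique_number F (intersection_edges F) \<le> t * r"
      "l ^ (d - 1) * r \<le> 12 * chromatic_number F (intersection_edges F)"
      using boxes_with_large_chromatic_number[where 'd = 'd, of l r n] assms(1) ld r(3)
      unfolding d_def t_def by auto
    have "real (clique_number F (intersection_edges F)) \<le> real (t * r)"
      using F(4) by (simp only: of_nat_le_iff)
    also have "\<dots> \<le> \<omega>" using r(1) tpos by (simp add: field_simps)
    finally have "real (clique_number F (intersection_edges F)) \<le> \<omega>" .
    moreover have "c' * \<omega> * L n ^ (d - 2) \<le> real (chromatic_number F (intersection_edges F))"
    proof -
      have ld2: "real l ^ (d - 1) = real l ^ (d - 2) * real l"
      proof -
        have "d - 1 = Suc (d - 2)" using d3 by simp
        then show ?thesis by simp
      qed
      have "c' * \<omega> * L n ^ (d - 2) \<le> (\<eta> / 2) ^ (d - 2) / (48 * real d ^ 3) * \<omega> * L n ^ (d - 2)"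
        using om Lpos by (intro mult_right_mono) (auto simp: c'_def)
      also have "\<dots> = (\<eta> / 2 * L n) ^ (d - 2) * (\<omega> / (48 * real d ^ 3))"
        by (simp only: power_mult_distrib) (simp add: mult_ac)
      also have "\<dots> \<le> real l ^ (d - 2) * (\<omega> / (48 * real d ^ 3))"
        using lhalf eta Lpos om by (intro mult_right_mono power_mono) auto
      also have "\<dots> = real l ^ (d - 1) * (\<omega> / real t) / 24"
        unfolding ld2 using lpos d3 by (simp add: t_def field_simps)
      also have "\<dots> \<le> real l ^ (d - 1) * (2 * real r) / 24"
        using rhalf by (intro divide_right_mono mult_left_mono) auto
      also have "\<dots> = real (l ^ (d - 1) * r) / 12" by simp
      also have "\<dots> \<le> real (12 * chromatic_number F (intersection_edges F)) / 12"
        using F(5) by (intro divide_right_mono) (simp_all only: of_nat_le_iff)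
      finally show ?thesis by simp
    qed
    ultimately show ?thesis using F by blast
  qed
  note main = this[unfolded L_def d_def]
  show ?thesis
  proof (rule exI[of _ c], rule exI[of _ c'], intro conjI allI impI)
    show "0 < c" "0 < c'" by (fact c)+
  qed (rule main; assumption)
qed

end
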